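(* The equation $\mathcal F(1,\zeta_h,\Lambda_h)=\mathbf 0$ has at least one solution $(\zeta_h,\Lambda_h)\in B_{R_0}$.
   Context: Data. $d\in\{2,3\}$, $\Omega\subset\mathbb R^d$ is a bounded connected Lipschitz polygon ($d=2$) or polyhedron ($d=3$), $T>0$. The porosity $\varphi$ is piecewise constant in space, independent of time, positive, bounded, and bounded away from zero. The mobilities $\eta_w,\eta_o:[0,1]\to[0,\infty)$ are continuous, $\eta_w$ is increasing, $\eta_o$ is decreasing, and $\eta_w+\eta_o\ge\eta_\ast$ on $[0,1]$ for a constant $\eta_\ast>0$. Set $f_w=\eta_w/(\eta_w+\eta_o)$, $f_o=1-f_w$. The capillary pressure $p_c\in W^{1,1}(0,1)$ is continuous and strictly decreasing. $\bar q,\underline q\in L^2(\Omega\times]0,T[)$, $\bar q\ge0$, $\underline q\ge0$, $\int_\Omega\bar q=\int_\Omega\underline q$ (at a.e. time); $0\le s_{\mathrm{in}}\le1$ a.e. The functions $p_c,\eta_\alpha,f_\alpha$ ($\alpha=w,o$) are extended continuously by constants to $\mathbb R$. Mesh. $\mathcal T_h$ is a regular (shape-regular) conforming simplicial mesh of $\Omega$ in which each angle is not larger than $\pi/2$, so that $\int_K\nabla\phi_i\cdot\nabla\phi_j\le0$ for all $K$ and $i\ne j$; $\varphi$ is constant on each element. $X_h$ is the space of continuous functions on $\overline\Omega$ that are affine on each $K\in\mathcal T_h$, with nodes $\mathbf x_1,\dots,\mathbf x_M$ and nodal basis $\phi_1,\dots,\phi_M$; superscripts $i$ denote nodal values; $I_h$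 is nodal interpolation. $X_{0,h}=\{\Lambda_h\in X_h:\int_\Omega\Lambda_h=0\}$. $\Delta_i$ is the union of the elements sharing node $i$; $c_{ij}=\int_{\Delta_i\cap\Delta_j}|\nabla\phi_i\cdot\nabla\phi_j|$; $m_i=\frac{|\Delta_i|}{d+1}$; $\tilde m_i(\varphi)=\frac1{d+1}\sum_{K\subset\Delta_i}\varphi|_K|K|$; $(U_h,V_h)_h=\sum_im_iU^iV^i$, $\|U_h\|_h=(U_h,U_h)_h^{1/2}$, $(U_h,V_h)_h^\varphi=\sum_i\tilde m_i(\varphi)U^iV^i$; $(\cdot,\cdot)$ is the $L^2(\Omega)$ inner product. Discrete data. $\tau=T/N$, $t_n=n\tau$; $\rho_\tau(f)$ equals $\frac1\tau\int_{t_{n-1}}^{t_n}f$ on $]t_{n-1},t_n]$; $r_h(f)\in X_h$ has nodal values $\frac1{|\Delta_i|}\int_{\Delta_i}f$; $s_{\mathrm{in},h}^n,\bar q_h^n,\underline q_h^n$ are the values on $]t_{n-1},t_n]$ of $\rho_\tau(r_h(s_{\mathrm{in}}))$, $\rho_\tau\big(r_h(\bar q)-\frac1{|\Omega|}\int_\Omega(r_h(\bar q)-\bar q)\big)$, and $\rho_\tau\big(r_h(\underline q)-\frac1{|\Omega|}\int_\Omega(r_h(\underline q)-\underline q)\big)$. The map $\mathcal F$. Fix $1\le n\le N$ and $S_h^{n-1}\in X_h$ with $0\le S_h^{n-1}\le1$, and a constant $\theta\in[0,1]$. For $t\in[0,1]$ and a function $f$ set $\widetilde f(s)=f(ts+(1-t)\theta)$.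 Define $\mathcal F:[0,1]\times X_h\times X_{0,h}\to X_h\times X_{0,h}$ by $\mathcal F(t,\zeta_h,\Lambda_h)=(A_h,A_h+B_h)$, where, with $P_{o,h}=\Lambda_h+I_h(\widetilde{p_c}(\zeta_h))$, for all $\Theta_h\in X_h$, $$(A_h,\Theta_h)=\tfrac1\tau(\zeta_h-S_h^{n-1},\Theta_h)_h^\varphi-\sum_{i,j=1}^M\Theta^ic_{ij}\widetilde{\eta_w}(\zeta_w^{ij})(\Lambda^j-\Lambda^i)-\big(I_h(\widetilde{f_w}(s_{\mathrm{in},h}^n))\,t\bar q_h^n-I_h(\widetilde{f_w}(\zeta_h))\,t\underline q_h^n,\Theta_h\big)_h,$$ $$(B_h,\Theta_h)=-\tfrac1\tau(\zeta_h-S_h^{n-1},\Theta_h)_h^\varphi-\sum_{i,j=1}^M\Theta^ic_{ij}\widetilde{\eta_o}(\zeta_o^{ij})(P_o^j-P_o^i)-\big(I_h(\widetilde{f_o}(s_{\mathrm{in},h}^n))\,t\bar q_h^n-I_h(\widetilde{f_o}(\zeta_h))\,t\underline q_h^n,\Theta_h\big)_h$$ (in the terms with $(\cdot,\cdot)_h$ only nodal values are used, products being taken nodewise). Upwinding: $\zeta_w^{ij}=\zeta^i$ if $\Lambda^i>\Lambda^j$, $\zeta^j$ if $\Lambda^i<\Lambda^j$, $\max(\zeta^i,\zeta^j)$ if $\Lambda^i=\Lambda^j$; $\zeta_o^{ij}=\zeta^i$ if $P_o^i>P_o^j$, $\zeta^j$ if $P_o^i<P_o^j$, $\min(\zeta^i,\zeta^j)$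 if $P_o^i=P_o^j$. Zeros of $\mathcal F(1,\cdot,\cdot)$ are exactly the solutions $(S_h^n,P_{w,h}^n)$ of one time step of the finite element scheme. The ball. $R_1>0$ is a constant, independent of $t$, such that every $(\zeta_h,\Lambda_h)\in X_h\times X_{0,h}$ with $\mathcal F(t,\zeta_h,\Lambda_h)=\mathbf 0$ for some $t\in[0,1]$ satisfies $\|\zeta_h\|_h+\|\Lambda_h\|_h\le R_1$ (such a constant exists); $R_0=R_1+1$ and $B_R=\{(\zeta_h,\Lambda_h)\in X_h\times X_{0,h}:\|\zeta_h\|_h+\|\Lambda_h\|_h\le R\}$. *)

theory Defs
  imports "HOL-Analysis.Analysis"
begin

section \<open>Domain, mesh geometry, and the space of capillary pressures\<close>

text \<open>
  Near every boundary point, \<open>\<Omega>\<close> is the strict epigraph, in some direction \<open>\<nu>\<close>, of a Lipschitz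
  function of the coordinates orthogonal to \<open>\<nu>\<close> (expressed as a function on the whole space that is
  constant along \<open>\<nu>\<close>).
\<close>

definition lipschitz_domain :: "'a::euclidean_space set \<Rightarrow> bool" where
  "lipschitz_domain \<Omega> \<longleftrightarrow> open \<Omega> \<and>
     (\<forall>p\<in>frontier \<Omega>. \<exists>\<nu> r L \<gamma>. norm \<nu> = 1 \<and> r > 0 \<and> L-lipschitz_on UNIV \<gamma> \<and>
        (\<forall>y s. \<gamma> (y + s *\<^sub>R \<nu>) = \<gamma> y) \<and>
        (\<forall>x\<in>ball p r. x \<in> \<Omega> \<longleftrightarrow> \<gamma> x < (x \<bullet> \<nu> :: real)))"

definition polyhedral_domain :: "'a::euclidean_space set \<Rightarrow> bool" where
  "polyhedral_domain \<Omega> \<longleftrightarrow> open \<Omega> \<and>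
     (\<exists>\<P>. finite \<P> \<and> (\<forall>P\<in>\<P>. polytope P) \<and> closure \<Omega> = \<Union>\<P>)"

definition vertices :: "'a::euclidean_space set \<Rightarrow> 'a set" where
  "vertices K = {v. v extreme_point_of K}"

text \<open>
  Conformity (two elements meet in a common, possibly empty, face) is part of
  \<^const>\<open>triangulation\<close>.
\<close>

definition simplicial_mesh :: "'a::euclidean_space set \<Rightarrow> 'a set set \<Rightarrow> bool" where
  "simplicial_mesh \<Omega> \<T> \<longleftrightarrow> triangulation \<T> \<and>
     (\<forall>K\<in>\<T>. int DIM('a) simplex K) \<and> \<Union>\<T> = closure \<Omega>"

definition inball_diameter :: "'a::euclidean_space set \<Rightarrow> real" where
  "inball_diameter K = Sup {2 * r | r. r > 0 \<and> (\<exists>x. ball x r \<subseteq> K)}"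

definition shape_regular :: "real \<Rightarrow> 'a::euclidean_space set set \<Rightarrow> bool" where
  "shape_regular \<sigma> \<T> \<longleftrightarrow> (\<forall>K\<in>\<T>. diameter K \<le> \<sigma> * inball_diameter K)"

text \<open>
  The angle of the simplex \<open>K\<close> between its facets opposite to the vertices \<open>a\<close> and \<open>b\<close>. These facets
  share the face spanned by the remaining vertices, and the angle is measured in the plane orthogonal
  to that face. For a triangle this is the interior angle at the third vertex, for a tetrahedron the
  dihedral angle along the edge joining the two other vertices.
\<close>

definition simplex_angle :: "'a::euclidean_space set \<Rightarrow> 'a \<Rightarrow> 'a \<Rightarrow> real" where
  "simplex_angle K a b =
     (let E = affine hull (vertices K - {a, b});
          u = a - closest_point E a;
          v = b - closest_point E b
      in arccos ((u \<bullet> v) / (norm u * norm v)))"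

definition nonobtuse :: "'a::euclidean_space set set \<Rightarrow> bool" where
  "nonobtuse \<T> \<longleftrightarrow>
     (\<forall>K\<in>\<T>. \<forall>a\<in>vertices K. \<forall>b\<in>vertices K. a \<noteq> b \<longrightarrow> simplex_angle K a b \<le> pi / 2)"

definition test_function :: "(real \<Rightarrow> real) \<Rightarrow> bool" where
  "test_function \<psi> \<longleftrightarrow> (\<forall>k x. (deriv ^^ k) \<psi> field_differentiable at x) \<and>
     (\<exists>a b. 0 < a \<and> b < 1 \<and> (\<forall>x. x \<notin> {a..b} \<longrightarrow> \<psi> x = 0))"

text \<open>The Sobolev space $W^{1,1}(0,1)$: integrable functions with an integrable weak derivative.\<close>

definition W11 :: "(real \<Rightarrow> real) \<Rightarrow> bool" where
  "W11 f \<longleftrightarrow> set_integrable lebesgue {0<..<1} f \<and>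
     (\<exists>g. set_integrable lebesgue {0<..<1} g \<and>
        (\<forall>\<psi>. test_function \<psi> \<longrightarrow>
           (LINT x:{0<..<1}|lebesgue. f x * deriv \<psi> x) = - (LINT x:{0<..<1}|lebesgue. g x * \<psi> x)))"

definition square_integrable_on :: "('a::euclidean_space \<Rightarrow> real) \<Rightarrow> 'a set \<Rightarrow> bool" where
  "square_integrable_on f S \<longleftrightarrow>
     f \<in> borel_measurable (lebesgue_on S) \<and> integrable (lebesgue_on S) (\<lambda>z. (f z)\<^sup>2)"

text \<open>Continuous extension by constants of a function on the unit interval.\<close>

definition ext01 :: "(real \<Rightarrow> real) \<Rightarrow> real \<Rightarrow> real" where
  "ext01 f s = f (max 0 (min 1 s))"

definition grad :: "('a::euclidean_space \<Rightarrow> real) \<Rightarrow> 'a \<Rightarrow> 'a" where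
  "grad f x = (THE D. GDERIV f x :> D)"


section \<open>One time step of the finite element scheme\<close>

text \<open>
  \<open>qI\<close> and \<open>qO\<close> are $\bar q$ and $\underline q$, and \<open>sI\<close> is $s_{\mathrm{in}}$; their arguments are
  space and time. \<open>S\<close> is $S_h^{n-1}$. The functions \<open>\<eta>w\<close>, \<open>\<eta>o\<close>, \<open>pc\<close> matter on \<open>{0..1}\<close> only.
\<close>

locale two_phase_scheme =
  fixes \<Omega> :: "(real ^ 'd) set" and T :: real
    and \<phi> :: "real ^ 'd \<Rightarrow> real"
    and \<eta>w \<eta>o pc :: "real \<Rightarrow> real"
    and sI qI qO :: "real ^ 'd \<Rightarrow> real \<Rightarrow> real"
    and \<T> :: "(real ^ 'd) set set" and \<sigma> :: real
    and N n :: nat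
    and S :: "real ^ 'd \<Rightarrow> real" and \<theta> :: real
begin

subsection \<open>Finite element spaces\<close>

text \<open>
  Functions on the closure of \<open>\<Omega>\<close> are represented by functions that vanish outside of it, so that
  equality of functions is equality on the closure. Nodal values $U^i$ are values \<open>U i\<close> at the
  node \<open>i\<close>: nodes are indexed by themselves.
\<close>

definition X_h :: "(real ^ 'd \<Rightarrow> real) set" where
  "X_h = {u. continuous_on (closure \<Omega>) u \<and> (\<forall>x. x \<notin> closure \<Omega> \<longrightarrow> u x = 0) \<and>
             (\<forall>K\<in>\<T>. \<exists>a b. \<forall>x\<in>K. u x = a \<bullet> x + b)}"

definition X0_h :: "(real ^ 'd \<Rightarrow> real) set" where
  "X0_h = {u \<in> X_h. (LINT x:\<Omega>|lebesgue. u x) = 0}"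

definition nodes :: "(real ^ 'd) set" where
  "nodes = (\<Union>K\<in>\<T>. vertices K)"

definition basis_fun :: "real ^ 'd \<Rightarrow> real ^ 'd \<Rightarrow> real" where
  "basis_fun i = (THE u. u \<in> X_h \<and> (\<forall>j\<in>nodes. u j = (if j = i then 1 else 0)))"

definition I_h :: "(real ^ 'd \<Rightarrow> real) \<Rightarrow> real ^ 'd \<Rightarrow> real" where
  "I_h g x = (\<Sum>i\<in>nodes. g i * basis_fun i x)"

definition patch :: "real ^ 'd \<Rightarrow> (real ^ 'd) set" where
  "patch i = \<Union>{K \<in> \<T>. i \<in> K}"

definition c :: "real ^ 'd \<Rightarrow> real ^ 'd \<Rightarrow> real" where
  "c i j = (LINT x:patch i \<inter> patch j|lebesgue. \<bar>grad (basis_fun i) x \<bullet> grad (basis_fun j) x\<bar>)"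

definition m :: "real ^ 'd \<Rightarrow> real" where
  "m i = measure lebesgue (patch i) / (real CARD('d) + 1)"

definition \<phi>_on :: "(real ^ 'd) set \<Rightarrow> real" where
  "\<phi>_on K = (THE a. \<forall>x\<in>interior K. \<phi> x = a)"

definition m_\<phi> :: "real ^ 'd \<Rightarrow> real" where
  "m_\<phi> i = (\<Sum>K | K \<in> \<T> \<and> i \<in> K. \<phi>_on K * measure lebesgue K) / (real CARD('d) + 1)"

definition inner_h :: "(real ^ 'd \<Rightarrow> real) \<Rightarrow> (real ^ 'd \<Rightarrow> real) \<Rightarrow> real" where
  "inner_h u v = (\<Sum>i\<in>nodes. m i * u i * v i)"

definition norm_h :: "(real ^ 'd \<Rightarrow> real) \<Rightarrow> real" where
  "norm_h u = sqrt (inner_h u u)"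

definition inner_\<phi>_h :: "(real ^ 'd \<Rightarrow> real) \<Rightarrow> (real ^ 'd \<Rightarrow> real) \<Rightarrow> real" where
  "inner_\<phi>_h u v = (\<Sum>i\<in>nodes. m_\<phi> i * u i * v i)"

definition ball_h :: "real \<Rightarrow> ((real ^ 'd \<Rightarrow> real) \<times> (real ^ 'd \<Rightarrow> real)) set" where
  "ball_h R = {(\<zeta>, \<Lambda>). \<zeta> \<in> X_h \<and> \<Lambda> \<in> X0_h \<and> norm_h \<zeta> + norm_h \<Lambda> \<le> R}"

subsection \<open>Discrete data\<close>

definition \<tau> :: real where
  "\<tau> = T / real N"

text \<open>The value of $\rho_\tau(g)$ on the time interval number \<open>n\<close>.\<close>

definition time_avg :: "(real \<Rightarrow> real) \<Rightarrow> real" where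
  "time_avg g = (LINT t:{(real n - 1) * \<tau><..real n * \<tau>}|lebesgue. g t) / \<tau>"

definition r_h :: "(real ^ 'd \<Rightarrow> real) \<Rightarrow> real ^ 'd \<Rightarrow> real" where
  "r_h f = I_h (\<lambda>i. (LINT y:patch i|lebesgue. f y) / measure lebesgue (patch i))"

definition r_h_balanced :: "(real ^ 'd \<Rightarrow> real) \<Rightarrow> real ^ 'd \<Rightarrow> real" where
  "r_h_balanced f x = r_h f x -
     indicator (closure \<Omega>) x * ((LINT y:\<Omega>|lebesgue. r_h f y - f y) / measure lebesgue \<Omega>)"

definition sI_h :: "real ^ 'd \<Rightarrow> real" where
  "sI_h x = time_avg (\<lambda>t. r_h (\<lambda>y. sI y t) x)"

definition qI_h :: "real ^ 'd \<Rightarrow> real" where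
  "qI_h x = time_avg (\<lambda>t. r_h_balanced (\<lambda>y. qI y t) x)"

definition qO_h :: "real ^ 'd \<Rightarrow> real" where
  "qO_h x = time_avg (\<lambda>t. r_h_balanced (\<lambda>y. qO y t) x)"

subsection \<open>The map $\mathcal F$\<close>

definition fw :: "real \<Rightarrow> real" where
  "fw s = \<eta>w s / (\<eta>w s + \<eta>o s)"

definition fo :: "real \<Rightarrow> real" where
  "fo s = 1 - fw s"

definition tilde :: "real \<Rightarrow> (real \<Rightarrow> real) \<Rightarrow> real \<Rightarrow> real" where
  "tilde t f s = ext01 f (t * s + (1 - t) * \<theta>)"

definition upw_w :: "(real ^ 'd \<Rightarrow> real) \<Rightarrow> (real ^ 'd \<Rightarrow> real) \<Rightarrow> real ^ 'd \<Rightarrow> real ^ 'd \<Rightarrow> real" where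
  "upw_w \<zeta> \<Lambda> i j =
     (if \<Lambda> i > \<Lambda> j then \<zeta> i else if \<Lambda> i < \<Lambda> j then \<zeta> j else max (\<zeta> i) (\<zeta> j))"

definition upw_o :: "(real ^ 'd \<Rightarrow> real) \<Rightarrow> (real ^ 'd \<Rightarrow> real) \<Rightarrow> real ^ 'd \<Rightarrow> real ^ 'd \<Rightarrow> real" where
  "upw_o \<zeta> P i j =
     (if P i > P j then \<zeta> i else if P i < P j then \<zeta> j else min (\<zeta> i) (\<zeta> j))"

definition P_o :: "real \<Rightarrow> (real ^ 'd \<Rightarrow> real) \<Rightarrow> (real ^ 'd \<Rightarrow> real) \<Rightarrow> real ^ 'd \<Rightarrow> real" where
  "P_o t \<zeta> \<Lambda> x = \<Lambda> x + I_h (\<lambda>i. tilde t pc (\<zeta> i)) x"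

definition source :: "real \<Rightarrow> (real \<Rightarrow> real) \<Rightarrow> (real ^ 'd \<Rightarrow> real) \<Rightarrow> real ^ 'd \<Rightarrow> real" where
  "source t f \<zeta> x = I_h (\<lambda>i. tilde t f (sI_h i)) x * (t * qI_h x)
                   - I_h (\<lambda>i. tilde t f (\<zeta> i)) x * (t * qO_h x)"

definition rhs_A ::
    "real \<Rightarrow> (real ^ 'd \<Rightarrow> real) \<Rightarrow> (real ^ 'd \<Rightarrow> real) \<Rightarrow> (real ^ 'd \<Rightarrow> real) \<Rightarrow> real" where
  "rhs_A t \<zeta> \<Lambda> \<Theta> =
     1 / \<tau> * inner_\<phi>_h (\<lambda>x. \<zeta> x - S x) \<Theta>
     - (\<Sum>i\<in>nodes. \<Sum>j\<in>nodes. \<Theta> i * c i j * tilde t \<eta>w (upw_w \<zeta> \<Lambda> i j) * (\<Lambda> j - \<Lambda> i))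
     - inner_h (source t fw \<zeta>) \<Theta>"

definition rhs_B ::
    "real \<Rightarrow> (real ^ 'd \<Rightarrow> real) \<Rightarrow> (real ^ 'd \<Rightarrow> real) \<Rightarrow> (real ^ 'd \<Rightarrow> real) \<Rightarrow> real" where
  "rhs_B t \<zeta> \<Lambda> \<Theta> =
     - 1 / \<tau> * inner_\<phi>_h (\<lambda>x. \<zeta> x - S x) \<Theta>
     - (\<Sum>i\<in>nodes. \<Sum>j\<in>nodes. \<Theta> i * c i j * tilde t \<eta>o (upw_o \<zeta> (P_o t \<zeta> \<Lambda>) i j)
          * (P_o t \<zeta> \<Lambda> j - P_o t \<zeta> \<Lambda> i))
     - inner_h (source t fo \<zeta>) \<Theta>"

text \<open>The element of \<open>X_h\<close> whose $L^2(\Omega)$ inner product with test functions is \<open>l\<close>.\<close>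

definition riesz :: "((real ^ 'd \<Rightarrow> real) \<Rightarrow> real) \<Rightarrow> real ^ 'd \<Rightarrow> real" where
  "riesz l = (THE u. u \<in> X_h \<and> (\<forall>\<Theta>\<in>X_h. (LINT x:\<Omega>|lebesgue. u x * \<Theta> x) = l \<Theta>))"

definition A_h :: "real \<Rightarrow> (real ^ 'd \<Rightarrow> real) \<Rightarrow> (real ^ 'd \<Rightarrow> real) \<Rightarrow> real ^ 'd \<Rightarrow> real" where
  "A_h t \<zeta> \<Lambda> = riesz (rhs_A t \<zeta> \<Lambda>)"

definition B_h :: "real \<Rightarrow> (real ^ 'd \<Rightarrow> real) \<Rightarrow> (real ^ 'd \<Rightarrow> real) \<Rightarrow> real ^ 'd \<Rightarrow> real" where
  "B_h t \<zeta> \<Lambda> = riesz (rhs_B t \<zeta> \<Lambda>)"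

definition F :: "real \<Rightarrow> (real ^ 'd \<Rightarrow> real) \<Rightarrow> (real ^ 'd \<Rightarrow> real)
    \<Rightarrow> (real ^ 'd \<Rightarrow> real) \<times> (real ^ 'd \<Rightarrow> real)" where
  "F t \<zeta> \<Lambda> = (A_h t \<zeta> \<Lambda>, \<lambda>x. A_h t \<zeta> \<Lambda> x + B_h t \<zeta> \<Lambda> x)"

end


section \<open>Standing assumptions\<close>

text \<open>
  The porosity may take arbitrary admissible values on the element boundaries, which form a null set;
  accordingly \<open>\<phi>_on\<close> above looks at interiors of elements only.
\<close>

locale two_phase_step = two_phase_scheme \<Omega> T \<phi> \<eta>w \<eta>o pc sI qI qO \<T> \<sigma> N n S \<theta>
  for \<Omega> :: "(real ^ 'd) set" and T :: real
    and \<phi> :: "real ^ 'd \<Rightarrow> real"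
    and \<eta>w \<eta>o pc :: "real \<Rightarrow> real"
    and sI qI qO :: "real ^ 'd \<Rightarrow> real \<Rightarrow> real"
    and \<T> :: "(real ^ 'd) set set" and \<sigma> :: real
    and N n :: nat
    and S :: "real ^ 'd \<Rightarrow> real" and \<theta> :: real +
  assumes dim: "CARD('d) \<in> {2, 3}"
    and domain: "\<Omega> \<noteq> {}" "bounded \<Omega>" "connected \<Omega>" "lipschitz_domain \<Omega>" "polyhedral_domain \<Omega>"
    and T_pos: "T > 0"
    and porosity_bounds: "\<exists>\<phi>min \<phi>max. 0 < \<phi>min \<and> (\<forall>x\<in>\<Omega>. \<phi>min \<le> \<phi> x \<and> \<phi> x \<le> \<phi>max)"
    and mobilities_cont: "continuous_on {0..1} \<eta>w" "continuous_on {0..1} \<eta>o"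
    and mobilities_nonneg: "\<And>s. s \<in> {0..1} \<Longrightarrow> 0 \<le> \<eta>w s" "\<And>s. s \<in> {0..1} \<Longrightarrow> 0 \<le> \<eta>o s"
    and mobilities_mono: "mono_on {0..1} \<eta>w" "antimono_on {0..1} \<eta>o"
    and total_mobility: "\<exists>\<eta>min>0. \<forall>s\<in>{0..1}. \<eta>min \<le> \<eta>w s + \<eta>o s"
    and pc: "W11 pc" "continuous_on {0..1} pc" "strict_antimono_on {0..1} pc"
    and q_L2: "square_integrable_on (\<lambda>(x, t). qI x t) (\<Omega> \<times> {0<..<T})"
      "square_integrable_on (\<lambda>(x, t). qO x t) (\<Omega> \<times> {0<..<T})"
    and q_nonneg: "AE (x, t) in lebesgue_on (\<Omega> \<times> {0<..<T}). 0 \<le> qI x t"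
      "AE (x, t) in lebesgue_on (\<Omega> \<times> {0<..<T}). 0 \<le> qO x t"
    and q_balance: "AE t in lebesgue_on {0<..<T}.
      (LINT x:\<Omega>|lebesgue. qI x t) = (LINT x:\<Omega>|lebesgue. qO x t)"
    and sI_measurable: "(\<lambda>(x, t). sI x t) \<in> borel_measurable (lebesgue_on (\<Omega> \<times> {0<..<T}))"
    and sI_bounds: "AE (x, t) in lebesgue_on (\<Omega> \<times> {0<..<T}). 0 \<le> sI x t \<and> sI x t \<le> 1"
    and mesh: "simplicial_mesh \<Omega> \<T>" "shape_regular \<sigma> \<T>" "nonobtuse \<T>"
    and porosity_mesh: "\<And>K. K \<in> \<T> \<Longrightarrow> \<exists>a. \<forall>x\<in>interior K. \<phi> x = a"
    and step: "1 \<le> n" "n \<le> N"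
    and S: "S \<in> X_h" "\<And>x. x \<in> closure \<Omega> \<Longrightarrow> 0 \<le> S x \<and> S x \<le> 1"
    and \<theta>: "\<theta> \<in> {0..1}"

end

theory Submission
  imports Defs
begin

text \<open>
  The zeros of \<open>F t\<close> are bounded uniformly in \<open>t\<close>, so it suffices to deform \<open>F 0\<close> to the identity without
  losing this bound. At \<open>t = 0\<close> the mobilities and the capillary pressure are constant and the sources
  vanish; testing \<open>(1 - \<alpha>) * \<Lambda> + \<alpha> * (A + B) = 0\<close> with \<open>\<Lambda>\<close> for \<open>\<alpha> < 1\<close> gives \<open>\<Lambda> = 0\<close>, and then each
  nodal value of \<open>\<zeta>\<close> is a multiple, with factor in the unit interval, of that of \<open>S\<close>. A homotopy from
  the identity whose zeros stay bounded ends in a map with a zero: following it at a parameter that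
  decreases from 1 to 0 with growing norm gives a map that is the identity far out, to which the
  Poincare-Miranda theorem applies on a large cube. The equations for \<open>A + B\<close> sum to zero because the
  discrete sources balance, which rests on the fact that a nodal basis function has integral \<open>m i\<close>. This
  redundancy is what allows the constraint of vanishing mean to be added to them.
\<close>

section \<open>Zeros of homotopies\<close>

lemma tendsto_fun_iff:
  fixes f :: "'a \<Rightarrow> 'b \<Rightarrow> 'c::topological_space"
  shows "(f \<longlongrightarrow> l) F \<longleftrightarrow> (\<forall>i. ((\<lambda>x. f x i) \<longlongrightarrow> l i) F)"
  using limitin_componentwise[of "\<lambda>_. euclidean" UNIV f l F]
  by (simp add: euclidean_product_topology)

text \<open>Kuhn's combinatorial lemma, applied on ever finer grids of the cube, yields cells whose
  vertices carry both weak signs in every component. By compactness the cells accumulate at a point,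
  which is a common zero by continuity.\<close>

lemma poincare_miranda_nat:
  fixes f :: "(nat \<Rightarrow> real) \<Rightarrow> nat \<Rightarrow> real"
  assumes a: "a > 0"
    and cont: "\<And>i. i < n \<Longrightarrow> continuous_on UNIV (\<lambda>x. f x i)"
    and lower: "\<And>x i. i < n \<Longrightarrow> x i = - a \<Longrightarrow> f x i \<le> 0"
    and upper: "\<And>x i. i < n \<Longrightarrow> x i = a \<Longrightarrow> 0 \<le> f x i"
  shows "\<exists>x. \<forall>i<n. f x i = 0"
proof -
  \<comment> \<open>\<open>y p q\<close> is the grid point with integer coordinates \<open>q\<close>
    when each side is cut into \<open>p\<close> pieces; coordinates from \<open>n\<close> on are 0,
    which keeps all grid points in one box. \<open>adj q r\<close> makes \<open>r\<close> a vertex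
    of the cell with lower corner \<open>q\<close>.\<close>
  define y where "y p q = (\<lambda>i. if i < n then 2 * a * (real (q i) / real p) - a else 0)" for p :: nat and q :: "nat \<Rightarrow> nat"
  define adj where "adj q r \<longleftrightarrow> (\<forall>j<n. q j \<le> r j \<and> r j \<le> q j + 1)" for q r :: "nat \<Rightarrow> nat"
  have "\<exists>q. (\<forall>i<n. q i < p) \<and> (\<forall>i<n. \<exists>r s. adj q r \<and> adj q s \<and> f (y p r) i \<le> 0 \<and> 0 \<le> f (y p s) i)"
    if "p > 0" for p
  proof -
    \<comment> \<open>The label is a sign, except that Kuhn's lemma demands 0 where
      \<open>q i = 0\<close> and 1 where \<open>q i = p\<close>. The sign conditions on the faces of
      the cube keep these forced labels true as weak signs.\<close>
    define label where
      "label q i = (if q i \<noteq> p \<and> f (y p q) i \<le> 0 \<or> q i = 0 then 0 else 1 :: nat)" for q i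
    have lab0: "f (y p q) i \<le> 0" if "i < n" "label q i = 0" for q i
      using that lower[of i "y p q"] by (auto simp: label_def y_def split: if_splits)
    have lab1: "0 \<le> f (y p q) i" if "i < n" "label q i \<noteq> 0" for q i
      using that upper[of i "y p q"] \<open>p > 0\<close> by (auto simp: label_def y_def split: if_splits)
    obtain q where q: "\<forall>i<n. q i < p"
      and rs: "\<forall>i<n. \<exists>r s. (\<forall>j<n. q j \<le> r j \<and> r j \<le> q j + 1) \<and>
          (\<forall>j<n. q j \<le> s j \<and> s j \<le> q j + 1) \<and> label r i \<noteq> label s i"
      by (rule kuhn_lemma[of p n label]) (use \<open>p > 0\<close> in \<open>auto simp: label_def\<close>)
    have "\<exists>r s. adj q r \<and> adj q s \<and> f (y p r) i \<le> 0 \<and> 0 \<le> f (y p s) i" if i: "i < n" for i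
    proof -
      obtain r s where rs: "adj q r" "adj q s" "label r i \<noteq> label s i"
        using rs i by (auto simp: adj_def)
      show ?thesis
      proof (cases "label r i = 0")
        case True
        then have "label s i \<noteq> 0" using rs by simp
        then show ?thesis using rs lab0[OF i True] lab1[OF i] by blast
      next
        case False
        then have "label s i = 0" using rs by (auto simp: label_def split: if_splits)
        then show ?thesis using rs lab0[OF i] lab1[OF i False] by blast
      qed
    qed
    with q show ?thesis by blast
  qed
  then have "\<forall>p. \<exists>q. (\<forall>i<n. q i < Suc p) \<and>
      (\<forall>i<n. \<exists>r s. adj q r \<and> adj q s \<and> f (y (Suc p) r) i \<le> 0 \<and> 0 \<le> f (y (Suc p) s) i)"
    by blast
  then obtain q where q: "\<And>p i. i < n \<Longrightarrow> q p i < Suc p"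
    and ex: "\<And>p i. i < n \<Longrightarrow> \<exists>r s. adj (q p) r \<and> adj (q p) s \<and>
        f (y (Suc p) r) i \<le> 0 \<and> 0 \<le> f (y (Suc p) s) i"
    by metis
  from ex have "\<forall>p i. \<exists>r s. i < n \<longrightarrow> adj (q p) r \<and> adj (q p) s \<and>
      f (y (Suc p) r) i \<le> 0 \<and> 0 \<le> f (y (Suc p) s) i"
    by blast
  then obtain r s where r: "\<And>p i. i < n \<Longrightarrow> adj (q p) (r p i) \<and> f (y (Suc p) (r p i)) i \<le> 0"
    and s: "\<And>p i. i < n \<Longrightarrow> adj (q p) (s p i) \<and> 0 \<le> f (y (Suc p) (s p i)) i"
    by metis
  have "compact (Pi\<^sub>E UNIV (\<lambda>_::nat. {-a..a}))"
    using compactin_PiE[of "\<lambda>_. euclidean" UNIV "\<lambda>_::nat. {-a..a}"]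
    by (simp add: euclidean_product_topology)
  moreover have "y (Suc p) (q p) \<in> Pi\<^sub>E UNIV (\<lambda>_. {-a..a})" for p
  proof -
    have "2 * a * (real (q p i) / real (Suc p)) - a \<in> {-a..a}" if "i < n" for i
    proof -
      have "real (q p i) / real (Suc p) \<le> 1" using q[OF that, of p] by simp
      then have "2 * a * (real (q p i) / real (Suc p)) \<le> 2 * a * 1"
        using a by (intro mult_left_mono) auto
      then show ?thesis using a by auto
    qed
    then show ?thesis using a by (auto simp: y_def)
  qed
  ultimately have "\<exists>x \<sigma>. strict_mono (\<sigma> :: nat \<Rightarrow> nat) \<and> ((\<lambda>p. y (Suc p) (q p)) \<circ> \<sigma>) \<longlonglongrightarrow> x"
    using compact_imp_seq_compact[unfolded seq_compact_def, rule_format,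
        of "Pi\<^sub>E UNIV (\<lambda>_::nat. {-a..a})" "\<lambda>p. y (Suc p) (q p)"] by blast
  then obtain x \<sigma> where \<sigma>: "strict_mono (\<sigma> :: nat \<Rightarrow> nat)"
    and lim: "(\<lambda>k. y (Suc (\<sigma> k)) (q (\<sigma> k))) \<longlonglongrightarrow> x"
    by (auto simp: o_def)
  \<comment> \<open>Every vertex of a cell is within one grid width of the lower corner in each
    coordinate, so all choices of vertices have the same limit.\<close>
  have close: "(\<lambda>k. y (Suc (\<sigma> k)) (z (\<sigma> k))) \<longlonglongrightarrow> x" if z: "\<And>p. adj (q p) (z p)" for z
    unfolding tendsto_fun_iff
  proof
    fix i
    have "(\<lambda>p. 2 * a / real (Suc p)) \<longlonglongrightarrow> 0"
      by (rule LIMSEQ_Suc[OF lim_const_over_n])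
    then have 0: "(\<lambda>k. 2 * a / real (Suc (\<sigma> k))) \<longlonglongrightarrow> 0"
      using LIMSEQ_subseq_LIMSEQ[OF _ \<sigma>] by (fastforce simp: o_def)
    have "\<bar>y (Suc (\<sigma> k)) (z (\<sigma> k)) i - y (Suc (\<sigma> k)) (q (\<sigma> k)) i\<bar> \<le> 2 * a / real (Suc (\<sigma> k))" for k
    proof (cases "i < n")
      case True
      let ?d = "real (z (\<sigma> k) i) - real (q (\<sigma> k) i)"
      have "y (Suc (\<sigma> k)) (z (\<sigma> k)) i - y (Suc (\<sigma> k)) (q (\<sigma> k)) i = 2 * a / real (Suc (\<sigma> k)) * ?d"
        using True by (simp add: y_def diff_divide_distrib right_diff_distrib)
      moreover have "0 \<le> ?d" "?d \<le> 1"
        using z[of "\<sigma> k"] True by (fastforce simp: adj_def)+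
      ultimately show ?thesis using a
        by (simp add: abs_mult mult_left_le divide_right_mono)
    qed (use a in \<open>simp add: y_def\<close>)
    then have "(\<lambda>k. y (Suc (\<sigma> k)) (z (\<sigma> k)) i - y (Suc (\<sigma> k)) (q (\<sigma> k)) i) \<longlonglongrightarrow> 0"
      by (intro Lim_null_comparison[OF _ 0]) auto
    from tendsto_add[OF this lim[unfolded tendsto_fun_iff, rule_format, of i]]
    show "(\<lambda>k. y (Suc (\<sigma> k)) (z (\<sigma> k)) i) \<longlonglongrightarrow> x i" by simp
  qed
  have "f x i = 0" if i: "i < n" for i
  proof -
    have c: "(\<lambda>k. f (w k) i) \<longlonglongrightarrow> f x i" if "w \<longlonglongrightarrow> x" for w
      using continuous_on_tendsto_compose[OF cont[OF i] that] by simp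
    have "f x i \<le> 0"
      using c[OF close[of "\<lambda>p. r p i"]] r[OF i] by (intro LIMSEQ_le_const2) auto
    moreover have "0 \<le> f x i"
      using c[OF close[of "\<lambda>p. s p i"]] s[OF i] by (intro LIMSEQ_le_const) auto
    ultimately show ?thesis by simp
  qed
  then show ?thesis by blast
qed

text \<open>An enumeration \<open>e\<close> of \<open>I\<close> reduces this to the indices below
  \<open>card I\<close>. The version over \<open>nat\<close> comes first because a countable index
  type makes the function space first countable, so that compact sets are sequentially
  compact.\<close>

lemma poincare_miranda:
  fixes f :: "('a \<Rightarrow> real) \<Rightarrow> 'a \<Rightarrow> real"
  assumes I: "finite I" and a: "a > 0"
    and cont: "\<And>i. i \<in> I \<Longrightarrow> continuous_on UNIV (\<lambda>x. f x i)"
    and lower: "\<And>x i. i \<in> I \<Longrightarrow> x i = - a \<Longrightarrow> f x i \<le> 0"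
    and upper: "\<And>x i. i \<in> I \<Longrightarrow> x i = a \<Longrightarrow> 0 \<le> f x i"
  shows "\<exists>x. \<forall>i\<in>I. f x i = 0"
proof -
  obtain e where e: "bij_betw e {..<card I} I"
    using ex_bij_betw_nat_finite[OF I] by (auto simp: atLeast0LessThan)
  define d where "d = the_inv_into {..<card I} e"
  have de: "d (e i) = i" if "i < card I" for i
    using e that by (simp add: d_def bij_betw_def the_inv_into_f_f)
  have eI: "e i \<in> I" if "i < card I" for i
    using e that by (auto simp: bij_betw_def)
  have "\<exists>z. \<forall>i<card I. f (\<lambda>j. z (d j)) (e i) = 0"
  proof (rule poincare_miranda_nat[OF a])
    show "continuous_on UNIV (\<lambda>z. f (\<lambda>j. z (d j)) (e i))" if "i < card I" for i
      by (rule continuous_on_compose2[OF cont[OF eI[OF that]]])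
        (auto intro!: continuous_on_coordinatewise_then_product)
  qed (use lower upper de eI in auto)
  then obtain z where "\<forall>i<card I. f (\<lambda>j. z (d j)) (e i) = 0" ..
  moreover have "\<exists>i<card I. e i = j" if "j \<in> I" for j
    using e that by (metis bij_betw_def imageE lessThan_iff)
  ultimately show ?thesis by metis
qed

text \<open>Takes the place of homotopy invariance of the degree: letting the parameter depend on
  the point merges the homotopy into a single map.\<close>

lemma homotopy_zero:
  fixes H :: "real \<Rightarrow> ('a \<Rightarrow> real) \<Rightarrow> 'a \<Rightarrow> real"
  assumes I: "finite I"
    and cont: "\<And>i. i \<in> I \<Longrightarrow> continuous_on ({0..1} \<times> UNIV) (\<lambda>(u, x). H u x i)"
    and id: "\<And>x i. i \<in> I \<Longrightarrow> H 0 x i = x i"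
    and bound: "\<And>u x i. u \<in> {0..1} \<Longrightarrow> (\<forall>j\<in>I. H u x j = 0) \<Longrightarrow> i \<in> I \<Longrightarrow> \<bar>x i\<bar> \<le> R"
  shows "\<exists>x. \<forall>i\<in>I. H 1 x i = 0"
proof -
  \<comment> \<open>\<open>R'\<close> bounds the sum norm \<open>N\<close> of every zero; the
    absolute value is there because no sign of \<open>R\<close> is assumed. The parameter
    \<open>l\<close> is 1 up to norm \<open>R'\<close> and 0 from norm \<open>R' + 1\<close>
    on.\<close>
  define R' where "R' = real (card I) * \<bar>R\<bar>"
  define N where "N x = (\<Sum>i\<in>I. \<bar>x i\<bar>)" for x :: "'a \<Rightarrow> real"
  define l where "l x = max 0 (min 1 (R' + 1 - N x))" for x
  have N: "\<bar>x i\<bar> \<le> N x" if "i \<in> I" for x i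
    unfolding N_def using I that by (intro member_le_sum) auto
  have l01: "l x \<in> {0..1}" for x
    by (auto simp: l_def)
  have contl: "continuous_on UNIV l"
    unfolding l_def N_def by (intro continuous_intros) auto
  have "\<exists>x. \<forall>i\<in>I. H (l x) x i = 0"
  proof (rule poincare_miranda[OF I])
    show "R' + 1 > 0" by (simp add: R'_def add_nonneg_pos)
    show "continuous_on UNIV (\<lambda>x. H (l x) x i)" if "i \<in> I" for i
    proof -
      have "continuous_on UNIV (\<lambda>x. (l x, x))"
        by (intro continuous_on_Pair contl continuous_on_id)
      then have "continuous_on UNIV (\<lambda>x. case (l x, x) of (u, x) \<Rightarrow> H u x i)"
        by (rule continuous_on_compose2[OF cont[OF that]]) (use l01 in auto)
      then show ?thesis by simp
    qed
    \<comment> \<open>On a face of the cube one coordinate alone brings \<open>N x\<close> to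
      \<open>R' + 1\<close>, so the map is the identity there and has the required signs.\<close>
    have far: "l x = 0" if "i \<in> I" "\<bar>x i\<bar> = R' + 1" for x i
      using N[OF that(1), of x] that(2) by (simp add: l_def)
    show "H (l x) x i \<le> 0" if "i \<in> I" "x i = - (R' + 1)" for x i
    proof -
      have "R' \<ge> 0" by (simp add: R'_def)
      then show ?thesis using far[of i x] id[of i x] that by simp
    qed
    show "0 \<le> H (l x) x i" if "i \<in> I" "x i = R' + 1" for x i
    proof -
      have "R' \<ge> 0" by (simp add: R'_def)
      then show ?thesis using far[of i x] id[of i x] that by simp
    qed
  qed
  then obtain x where x: "\<forall>i\<in>I. H (l x) x i = 0" ..
  \<comment> \<open>The point \<open>x\<close> is a zero of the homotopy at the parameter
    \<open>l x\<close>, so the uniform bound applies to it and forces this parameter to be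
    1.\<close>
  have "N x \<le> R'"
    unfolding N_def R'_def using bound[OF l01 x] by (intro sum_bounded_above) fastforce
  then have "l x = 1" by (simp add: l_def)
  with x show ?thesis by auto
qed

section \<open>Affine functions on simplices\<close>

text \<open>Moving one point of \<open>C\<close> to the origin turns affine into linear
  independence, and a linear functional with prescribed values on an independent set exists.\<close>

lemma affine_independent_interpolation:
  fixes C :: "'a::euclidean_space set"
  assumes C: "\<not> affine_dependent C"
  shows "\<exists>a b. \<forall>v\<in>C. a \<bullet> v + b = g v"
proof (cases "C = {}")
  case False
  then obtain c where c: "c \<in> C" by blast
  define B where "B = (\<lambda>x. - c + x) ` (C - {c})"
  have "independent B"
    using C affine_dependent_iff_dependent2[OF c] by (simp add: B_def)
  then obtain f where f: "linear f" "\<forall>x\<in>B. f x = g (c + x) - g c"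
    using linear_independent_extend[OF \<open>independent B\<close>, of "\<lambda>x. g (c + x) - g c"] by blast
  \<comment> \<open>The vector that represents the functional \<open>f\<close> as an inner
    product.\<close>
  define a where "a = adjoint f 1"
  have a: "a \<bullet> x = f x" for x
    using adjoint_works[OF f(1), of x 1] by (simp add: a_def inner_commute)
  have "a \<bullet> v + (g c - a \<bullet> c) = g v" if "v \<in> C" for v
  proof (cases "v = c")
    case False
    then have "- c + v \<in> B" using that by (auto simp: B_def)
    then have "f (- c + v) = g v - g c" using f(2) by auto
    then show ?thesis using a[of "- c + v"] by (simp add: inner_right_distrib inner_diff_right)
  qed auto
  then show ?thesis by blast
qed auto

text \<open>The set where two affine functions agree is given by one linear equation and hence
  convex.\<close>

lemma affine_eq_on_convex_hull:
  fixes a a' :: "'a::euclidean_space"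
  assumes "\<And>v. v \<in> C \<Longrightarrow> a \<bullet> v + b = a' \<bullet> v + b'" "x \<in> convex hull C"
  shows "a \<bullet> x + b = a' \<bullet> x + b'"
proof -
  have eq: "{x. a \<bullet> x + b = a' \<bullet> x + b'} = {x. (a - a') \<bullet> x = b' - b}"
    by (auto simp: inner_diff_left)
  have "convex hull C \<subseteq> {x. a \<bullet> x + b = a' \<bullet> x + b'}"
  proof (rule hull_minimal)
    show "convex {x. a \<bullet> x + b = a' \<bullet> x + b'}"
      unfolding eq by (rule convex_hyperplane)
  qed (use assms(1) in auto)
  then show ?thesis using assms(2) by auto
qed

text \<open>The affine function reads off the weight of \<open>v0\<close> in a convex combination.
  Reserving the weight \<open>s\<close> for \<open>v0\<close> and distributing the remaining
  \<open>1 - s\<close> freely is a homothety centred at \<open>v0\<close>.\<close>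

lemma superlevel_barycentric:
  fixes C :: "'a::euclidean_space set"
  assumes C: "finite C" and v0: "v0 \<in> C" and s: "0 \<le> s" "s < 1"
    and l: "\<And>v. v \<in> C \<Longrightarrow> a \<bullet> v + b = (if v = v0 then 1 else 0)"
  shows "{x \<in> convex hull C. s \<le> a \<bullet> x + b} = (\<lambda>x. (1 - s) *\<^sub>R x + s *\<^sub>R v0) ` (convex hull C)"
proof -
  have lv: "a \<bullet> (\<Sum>v\<in>C. u v *\<^sub>R v) + b = u v0" if "sum u C = 1" for u
  proof -
    have "a \<bullet> (\<Sum>v\<in>C. u v *\<^sub>R v) + b = (\<Sum>v\<in>C. u v * (a \<bullet> v + b))"
      using that by (simp add: inner_sum_right distrib_left sum.distrib flip: sum_distrib_right)
    also have "\<dots> = (\<Sum>v\<in>C. if v = v0 then u v else 0)"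
      by (rule sum.cong) (auto simp: l)
    finally show ?thesis using C v0 by simp
  qed
  show ?thesis
  proof (intro equalityI subsetI)
    fix x assume x: "x \<in> {x \<in> convex hull C. s \<le> a \<bullet> x + b}"
    then obtain u where u: "\<forall>v\<in>C. 0 \<le> u v" "sum u C = 1" "(\<Sum>v\<in>C. u v *\<^sub>R v) = x"
      by (auto simp: convex_hull_finite[OF C])
    have su: "s \<le> u v0" using x lv[OF u(2)] u(3) by simp
    \<comment> \<open>The weights of the preimage under the homothety: the reserved weight
      \<open>s\<close> is removed from \<open>v0\<close> and the rest is rescaled to total
      1.\<close>
    define w where "w v = (u v - (if v = v0 then s else 0)) / (1 - s)" for v
    have w: "(1 - s) * w v = u v - (if v = v0 then s else 0)" for v
      using s by (simp add: w_def)
    have "(1 - s) * sum w C = 1 - s"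
      using u(2) C v0 by (simp add: sum_distrib_left w sum_subtractf)
    then have "sum w C = 1" using s by simp
    moreover have "0 \<le> w v" if "v \<in> C" for v
      using u(1) that su s by (simp add: w_def)
    ultimately have "(\<Sum>v\<in>C. w v *\<^sub>R v) \<in> convex hull C"
      by (auto simp: convex_hull_finite[OF C])
    moreover have "x = (1 - s) *\<^sub>R (\<Sum>v\<in>C. w v *\<^sub>R v) + s *\<^sub>R v0"
    proof -
      have "(1 - s) *\<^sub>R (\<Sum>v\<in>C. w v *\<^sub>R v) = (\<Sum>v\<in>C. u v *\<^sub>R v) - (\<Sum>v\<in>C. if v = v0 then s *\<^sub>R v else 0)"
        by (simp add: scaleR_sum_right w scaleR_diff_left flip: sum_subtractf) (rule sum.cong; simp)
      then show ?thesis using u(3) C v0 by simp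
    qed
    ultimately show "x \<in> (\<lambda>x. (1 - s) *\<^sub>R x + s *\<^sub>R v0) ` (convex hull C)" by blast
  next
    fix x assume "x \<in> (\<lambda>x. (1 - s) *\<^sub>R x + s *\<^sub>R v0) ` (convex hull C)"
    then obtain y where y: "y \<in> convex hull C" "x = (1 - s) *\<^sub>R y + s *\<^sub>R v0" by blast
    then obtain u where u: "\<forall>v\<in>C. 0 \<le> u v" "sum u C = 1" "(\<Sum>v\<in>C. u v *\<^sub>R v) = y"
      by (auto simp: convex_hull_finite[OF C])
    have "v0 \<in> convex hull C" using v0 by (rule hull_inc)
    then have "x \<in> convex hull C"
      using convexD[OF convex_convex_hull, of y C v0 "1 - s" s] y s by simp
    moreover have "a \<bullet> x + b = (1 - s) * (a \<bullet> y + b) + s * (a \<bullet> v0 + b)"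
      by (simp add: y(2) inner_right_distrib algebra_simps)
    then have "s \<le> a \<bullet> x + b"
      using lv[OF u(2)] u(1,3) v0 l[OF v0] s by simp
    ultimately show "x \<in> {x \<in> convex hull C. s \<le> a \<bullet> x + b}" by simp
  qed
qed

text \<open>By the layer-cake formula, since the superlevel sets are homothetic copies of the simplex.\<close>

lemma integral_barycentric:
  fixes C :: "'a::euclidean_space set"
  assumes C: "finite C" and v0: "v0 \<in> C"
    and l: "\<And>v. v \<in> C \<Longrightarrow> a \<bullet> v + b = (if v = v0 then 1 else 0)"
  shows "(LINT x:convex hull C|lebesgue. a \<bullet> x + b) = measure lebesgue (convex hull C) / (DIM('a) + 1)"
proof -
  let ?K = "convex hull C" and ?l = "\<lambda>x. a \<bullet> x + b" and ?d = "DIM('a)"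
  have K: "compact ?K" using C by (simp add: finite_imp_compact_convex_hull)
  have Kb [measurable]: "?K \<in> sets borel" using K by (simp add: borel_compact)
  have l0: "0 \<le> ?l x" "?l x \<le> 1" if "x \<in> ?K" for x
  proof -
    have "convex hull C \<subseteq> {x. - a \<bullet> x \<le> b} \<inter> {x. a \<bullet> x \<le> 1 - b}"
      by (rule hull_minimal) (use l in \<open>force split: if_splits\<close>, intro convex_Int convex_halfspace_le)
    then show "0 \<le> ?l x" "?l x \<le> 1" using that by auto
  qed
  \<comment> \<open>A homothety of ratio \<open>1 - s\<close> scales volume by the
    \<open>d\<close>-th power of the ratio.\<close>
  have sup: "emeasure lborel {x \<in> ?K. s \<le> ?l x} = ennreal ((1 - s) ^ ?d * measure lebesgue ?K)"
    if "0 \<le> s" "s < 1" for s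
  proof -
    have "emeasure lborel {x \<in> ?K. s \<le> ?l x} = emeasure lebesgue {x \<in> ?K. s \<le> ?l x}"
      by simp
    also have "\<dots> = ennreal (\<bar>1 - s\<bar> ^ ?d) * emeasure lebesgue ?K"
      by (subst superlevel_barycentric[OF C v0 that l], assumption)
        (use emeasure_lebesgue_affine[of "1 - s" "s *\<^sub>R v0" ?K] in \<open>simp add: ennreal_power\<close>)
    also have "emeasure lebesgue ?K = ennreal (measure lebesgue ?K)"
      using K by (intro emeasure_eq_measure2 lmeasurable_compact)
    finally show ?thesis using that by (simp add: ennreal_mult)
  qed
  \<comment> \<open>The integrand is the length of the interval of levels \<open>s\<close> below it,
    and then the integrals over points and levels are exchanged. This is done for
    \<open>lborel\<close>, where the product measure is available.\<close>
  have "(\<integral>\<^sup>+x. ennreal (indicator ?K x * ?l x) \<partial>lborel) =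
      (\<integral>\<^sup>+x. (\<integral>\<^sup>+s. indicator ({0..1} \<times> ?K \<inter> {(s, x). s \<le> ?l x}) (s, x) \<partial>lborel) \<partial>lborel)"
  proof (rule nn_integral_cong)
    fix x
    show "ennreal (indicator ?K x * ?l x) =
        (\<integral>\<^sup>+s. indicator ({0..1} \<times> ?K \<inter> {(s, x). s \<le> ?l x}) (s, x) \<partial>lborel)"
    proof (cases "x \<in> ?K")
      case True
      have "(\<integral>\<^sup>+s. indicator ({0..1} \<times> ?K \<inter> {(s, x). s \<le> ?l x}) (s, x) \<partial>lborel) = (\<integral>\<^sup>+s. indicator {0..?l x} s \<partial>lborel)"
        by (rule nn_integral_cong) (use True l0[OF True] in \<open>auto simp: indicator_def\<close>)
      then show ?thesis using True l0[OF True] by simp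
    qed simp
  qed
  also have "\<dots> = (\<integral>\<^sup>+s. (\<integral>\<^sup>+x. indicator ({0..1} \<times> ?K \<inter> {(s, x). s \<le> ?l x}) (s, x) \<partial>lborel) \<partial>lborel)"
    by (rule lborel_pair.Fubini') measurable
  also have "\<dots> = (\<integral>\<^sup>+s. ennreal ((1 - s) ^ ?d * measure lebesgue ?K) * indicator {0..1} s \<partial>lborel)"
  proof (rule nn_integral_cong_AE)
    \<comment> \<open>At the level 1 the homothety degenerates; this single level is discarded as a
      null set.\<close>
    have "AE s in lborel. s \<noteq> (1::real)" by (rule AE_lborel_singleton)
    then show "AE s in lborel. (\<integral>\<^sup>+x. indicator ({0..1} \<times> ?K \<inter> {(s, x). s \<le> ?l x}) (s, x) \<partial>lborel) =
        ennreal ((1 - s) ^ ?d * measure lebesgue ?K) * indicator {0..1} s"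
    proof eventually_elim
      case (elim s)
      show ?case
      proof (cases "s \<in> {0..1}")
        case True
        have "(\<integral>\<^sup>+x. indicator ({0..1} \<times> ?K \<inter> {(s, x). s \<le> ?l x}) (s, x) \<partial>lborel) =
            (\<integral>\<^sup>+x. indicator {x \<in> ?K. s \<le> ?l x} x \<partial>lborel)"
          by (rule nn_integral_cong) (use True in \<open>auto simp: indicator_def\<close>)
        then show ?thesis using True elim sup[of s] by simp
      next
        case False
        then show ?thesis
          by (subst nn_integral_cong[where v="\<lambda>_. 0"]) (auto simp: indicator_def)
      qed
    qed
  qed
  also have "\<dots> = ennreal (measure lebesgue ?K / (?d + 1))"
  proof -
    \<comment> \<open>Chosen so that \<open>(1 - s) ^ Suc ?d * \<kappa>\<close> is an
      antiderivative; it vanishes at 1 and equals \<kappa> at 0, so the integral is the negative of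
      \<kappa>.\<close>
    define \<kappa> where "\<kappa> = - (measure lebesgue ?K / real (Suc ?d))"
    have \<kappa>: "measure lebesgue ?K = - real (Suc ?d) * \<kappa>"
      by (simp add: \<kappa>_def del: of_nat_Suc)
    have "((\<lambda>s. (1 - s) ^ Suc ?d * \<kappa>) has_real_derivative (1 - s) ^ ?d * measure lebesgue ?K) (at s)"
      for s :: real
      unfolding \<kappa> by (auto intro!: derivative_eq_intros simp del: power_Suc simp: algebra_simps)
    from nn_integral_FTC_Icc[OF _ this, of 0 1] show ?thesis
      by (simp add: \<kappa>_def add.commute)
  qed
  finally have nn: "(\<integral>\<^sup>+x. ennreal (indicator ?K x * ?l x) \<partial>lborel) = ennreal (measure lebesgue ?K / (?d + 1))" .
  have "(LINT x:?K|lebesgue. ?l x) = (LINT x|lborel. indicator ?K x * ?l x)"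
    unfolding set_lebesgue_integral_def by (subst integral_completion) auto
  also have "\<dots> = enn2real (\<integral>\<^sup>+x. ennreal (indicator ?K x * ?l x) \<partial>lborel)"
    by (rule integral_eq_nn_integral) (use l0 in \<open>auto simp: indicator_def\<close>)
  finally show ?thesis by (simp add: nn)
qed

text \<open>Expand \<open>u\<close> in barycentric coordinates, all of which have the same integral.
  This is the exactness of the vertex quadrature rule on affine functions.\<close>

lemma integral_affine_simplex:
  fixes C :: "'a::euclidean_space set"
  assumes C: "\<not> affine_dependent C"
    and u: "\<And>x. x \<in> convex hull C \<Longrightarrow> u x = a \<bullet> x + b"
  shows "(LINT x:convex hull C|lebesgue. u x) = measure lebesgue (convex hull C) / (DIM('a) + 1) * (\<Sum>v\<in>C. u v)"
proof -
  let ?K = "convex hull C"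
  have fin: "finite C" using C by (rule aff_independent_finite)
  have K: "compact ?K" using fin by (simp add: finite_imp_compact_convex_hull)
  have "\<forall>v0. \<exists>a b. \<forall>v\<in>C. a \<bullet> v + b = (if v = v0 then 1 else (0::real))"
    by (intro allI affine_independent_interpolation C)
  then obtain A B where l: "\<And>v0 v. v \<in> C \<Longrightarrow> A v0 \<bullet> v + B v0 = (if v = v0 then 1 else (0::real))"
    by metis
  have int: "set_integrable lebesgue ?K (\<lambda>x. p \<bullet> x + q)" for p q
  proof -
    have "set_integrable lborel ?K (\<lambda>x. p \<bullet> x + q)"
      unfolding set_integrable_def by (intro borel_integrable_compact K continuous_intros)
    then show ?thesis
      unfolding set_integrable_def
      by (subst integrable_completion) (use K in \<open>auto simp: borel_compact\<close>)
  qed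
  \<comment> \<open>Both sides are affine and agree at the vertices.\<close>
  have ux: "u x = (\<Sum>v\<in>C. u v * (A v \<bullet> x + B v))" if "x \<in> ?K" for x
  proof -
    have "(\<Sum>v\<in>C. u v *\<^sub>R A v) \<bullet> w + (\<Sum>v\<in>C. u v * B v) = a \<bullet> w + b" if "w \<in> C" for w
    proof -
      have "(\<Sum>v\<in>C. u v *\<^sub>R A v) \<bullet> w + (\<Sum>v\<in>C. u v * B v) = (\<Sum>v\<in>C. u v * (A v \<bullet> w + B v))"
        by (simp add: inner_sum_left distrib_left sum.distrib)
      also have "\<dots> = (\<Sum>v\<in>C. if v = w then u v else 0)"
        by (rule sum.cong) (auto simp: l[OF that])
      finally show ?thesis using that fin u[of w] by (simp add: hull_inc)
    qed
    from affine_eq_on_convex_hull[OF this \<open>x \<in> ?K\<close>] show ?thesis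
      using u[OF that] by (simp add: inner_sum_left distrib_left sum.distrib)
  qed
  have "(LINT x:?K|lebesgue. u x) = (LINT x:?K|lebesgue. \<Sum>v\<in>C. u v * (A v \<bullet> x + B v))"
    by (rule set_lebesgue_integral_cong) (use ux K in \<open>auto simp: borel_compact\<close>)
  also have "\<dots> = (LINT x|lebesgue. (\<Sum>v\<in>C. u v * (indicator ?K x * (A v \<bullet> x + B v))))"
    by (simp add: set_lebesgue_integral_def sum_distrib_left mult.left_commute)
  also have "\<dots> = (\<Sum>v\<in>C. u v * (LINT x:?K|lebesgue. A v \<bullet> x + B v))"
    using int unfolding set_lebesgue_integral_def set_integrable_def
    by (subst Bochner_Integration.integral_sum) auto
  also have "\<dots> = (\<Sum>v\<in>C. u v * (measure lebesgue ?K / (DIM('a) + 1)))"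
    by (rule sum.cong) (auto simp: integral_barycentric[OF fin _ l])
  finally show ?thesis by (simp add: sum_distrib_right sum_divide_distrib mult.commute)
qed

section \<open>Nodal interpolation and mass lumping\<close>

text \<open>Integrability transfers between the two sets. Where it fails, it fails on both, and both
  integrals take the default value 0.\<close>

lemma
  fixes f :: "'a::euclidean_space \<Rightarrow> real"
  assumes "negligible (A - B)" "negligible (B - A)"
  shows set_integrable_lebesgue_spike: "set_integrable lebesgue A f \<longleftrightarrow> set_integrable lebesgue B f"
    and set_integral_lebesgue_spike: "(LINT x:A|lebesgue. f x) = (LINT x:B|lebesgue. f x)"
proof -
  have neg: "negligible {x \<in> A - B. f x \<noteq> 0}" "negligible {x \<in> B - A. f x \<noteq> 0}"
    using assms by (auto intro: negligible_subset)
  show *: "set_integrable lebesgue A f \<longleftrightarrow> set_integrable lebesgue B f"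
    by (rule absolutely_integrable_spike_set_eq[OF neg])
  show "(LINT x:A|lebesgue. f x) = (LINT x:B|lebesgue. f x)"
  proof (cases "set_integrable lebesgue A f")
    case True
    with * show ?thesis
      by (simp add: set_lebesgue_integral_eq_integral integral_spike_set[OF neg])
  next
    case False
    with * show ?thesis
      by (simp add: set_lebesgue_integral_def set_integrable_def not_integrable_integral_eq)
  qed
qed

text \<open>The Lipschitz graph condition puts points outside the closure arbitrarily near each
  boundary point, so every boundary point of \<Omega> is one of its closure. The closure is a finite
  union of convex sets, whose frontiers are negligible.\<close>

lemma negligible_frontier_lipschitz_domain:
  fixes \<Omega> :: "'a::euclidean_space set"
  assumes lip: "lipschitz_domain \<Omega>" and \<T>: "finite \<T>" "\<And>K. K \<in> \<T> \<Longrightarrow> convex K" "\<Union>\<T> = closure \<Omega>"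
  shows "negligible (frontier \<Omega>)"
proof -
  have "frontier \<Omega> \<subseteq> frontier (closure \<Omega>)"
  proof
    fix p assume p: "p \<in> frontier \<Omega>"
    then obtain \<nu> r L \<gamma> where \<nu>: "norm \<nu> = 1" and r: "r > 0"
      and \<gamma>: "\<And>y s. \<gamma> (y + s *\<^sub>R \<nu>) = \<gamma> y" "L-lipschitz_on UNIV \<gamma>"
      and ball: "\<And>x. x \<in> ball p r \<Longrightarrow> x \<in> \<Omega> \<longleftrightarrow> \<gamma> x < x \<bullet> \<nu>"
      using lip unfolding lipschitz_domain_def by (metis (no_types, lifting))
    have "open \<Omega>" using lip by (simp add: lipschitz_domain_def)
    then have "p \<notin> \<Omega>" using p by (simp add: frontier_def interior_open)
    then have "p \<bullet> \<nu> \<le> \<gamma> p" using ball[of p] r by auto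
    have cont: "continuous_on UNIV \<gamma>" using \<gamma>(2) by (rule lipschitz_on_continuous_on)
    \<comment> \<open>The part of the ball strictly below the graph: open and disjoint from
      \<Omega>, hence disjoint from its closure.\<close>
    define U where "U = ball p r \<inter> {x. x \<bullet> \<nu> < \<gamma> x}"
    have "open U" unfolding U_def
      by (intro open_Int open_ball open_Collect_less continuous_intros cont)
    moreover have "U \<inter> \<Omega> = {}" using ball by (force simp: U_def)
    ultimately have U: "U \<inter> closure \<Omega> = {}" by (simp add: open_Int_closure_eq_empty)
    have "p \<notin> interior (closure \<Omega>)"
    proof
      assume "p \<in> interior (closure \<Omega>)"
      then obtain e where e: "e > 0" "ball p e \<subseteq> closure \<Omega>"
        using mem_interior by blast
      \<comment> \<open>A step of this length from \<open>p\<close> against \<nu> stays in both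
        balls and leads into \<open>U\<close>, because \<gamma> is constant along \<nu>.\<close>
      define s where "s = min e r / 2"
      have s: "0 < s" "s < e" "s < r" using e r by (auto simp: s_def)
      let ?x = "p + (- s) *\<^sub>R \<nu>"
      have d: "dist p ?x = s" using \<nu> s by (simp add: dist_norm)
      have "?x \<bullet> \<nu> = p \<bullet> \<nu> - s" using \<nu> by (simp add: inner_add_left inner_diff_left dot_square_norm)
      then have "?x \<bullet> \<nu> < \<gamma> ?x"
        unfolding \<gamma>(1) using \<open>p \<bullet> \<nu> \<le> \<gamma> p\<close> s by simp
      then have "?x \<in> U" using d s by (simp add: U_def)
      moreover have "?x \<in> closure \<Omega>" using e d s by auto
      ultimately show False using U by blast
    qed
    then show "p \<in> frontier (closure \<Omega>)"
      using p by (simp add: frontier_def)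
  qed
  also have "\<dots> \<subseteq> \<Union>(frontier ` \<T>)"
    using frontier_Union_subset[OF \<T>(1)] \<T>(3) by simp
  finally show ?thesis
    by (rule negligible_subset[rotated]) (use \<T> in \<open>auto intro!: negligible_convex_frontier\<close>)
qed

context two_phase_step
begin

section \<open>Geometry of the conforming simplicial mesh\<close>

lemma finite_mesh: "finite \<T>"
  using mesh(1) by (simp add: simplicial_mesh_def triangulation_def)

lemma Union_mesh: "\<Union>\<T> = closure \<Omega>"
  using mesh(1) by (simp add: simplicial_mesh_def)

lemma
  assumes "K \<in> \<T>"
  shows vertices_independent: "\<not> affine_dependent (vertices K)"
    and hull_vertices: "convex hull (vertices K) = K"
    and aff_dim_mesh: "aff_dim K = int CARD('d)"
proof -
  have K: "int CARD('d) simplex K"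
    using assms mesh(1) by (simp add: simplicial_mesh_def)
  then obtain C where C: "\<not> affine_dependent C" "K = convex hull C"
    by (auto simp: simplex_def)
  then have "vertices K = C"
    by (auto simp: vertices_def extreme_point_of_convex_hull_affine_independent)
  with C show "\<not> affine_dependent (vertices K)" "convex hull (vertices K) = K" by auto
  show "aff_dim K = int CARD('d)"
    using K by (rule aff_dim_simplex)
qed

lemma finite_vertices: "K \<in> \<T> \<Longrightarrow> finite (vertices K)"
  using vertices_independent by (rule aff_independent_finite)

lemma compact_mesh: "K \<in> \<T> \<Longrightarrow> compact K"
  using finite_imp_compact_convex_hull[OF finite_vertices] hull_vertices by metis

lemma convex_mesh: "K \<in> \<T> \<Longrightarrow> convex K"
  using hull_vertices by (metis convex_convex_hull)

lemma vertices_subset: "vertices K \<subseteq> K"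
  by (auto simp: vertices_def extreme_point_of_def)

lemma finite_nodes: "finite nodes"
  unfolding nodes_def using finite_mesh finite_vertices by auto

lemma mesh_subset: "K \<in> \<T> \<Longrightarrow> K \<subseteq> closure \<Omega>"
  using Union_mesh by auto

lemma nodes_subset: "nodes \<subseteq> closure \<Omega>"
  unfolding nodes_def using mesh_subset vertices_subset by blast

lemma mesh_face: "K \<in> \<T> \<Longrightarrow> K' \<in> \<T> \<Longrightarrow> (K \<inter> K') face_of K"
  using mesh(1) by (simp add: simplicial_mesh_def triangulation_def)

text \<open>There are no hanging nodes: \<open>i\<close> is an extreme point of some element, hence
  of the common face with \<open>K\<close>, and an extreme point of a face of \<open>K\<close> is
  one of \<open>K\<close>.\<close>

lemma vertices_if_node:
  assumes "i \<in> nodes" "K \<in> \<T>" "i \<in> K"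
  shows "i \<in> vertices K"
proof -
  obtain K' where K': "K' \<in> \<T>" "i extreme_point_of K'"
    using assms(1) by (auto simp: nodes_def vertices_def)
  then have "i \<in> K'" by (simp add: extreme_point_of_def)
  then have "i extreme_point_of (K' \<inter> K)"
    using K' assms extreme_point_of_face[OF mesh_face, of K' K] by auto
  then show ?thesis
    using extreme_point_of_face[OF mesh_face, of K K' i] K'(1) assms
    by (simp add: vertices_def Int_commute)
qed

text \<open>A face of a simplex is spanned by some of its vertices, and those lying in the other
  element are vertices there too. This makes elementwise interpolants agree where elements
  meet.\<close>

lemma mesh_Int:
  assumes "K \<in> \<T>" "K' \<in> \<T>"
  shows "K \<inter> K' = convex hull (vertices K \<inter> vertices K')"
proof -
  have "(K \<inter> K') face_of (convex hull (vertices K))"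
    using mesh_face[OF assms] hull_vertices[OF assms(1)] by simp
  then obtain c where c: "c \<subseteq> vertices K" "K \<inter> K' = convex hull c"
    using face_of_convex_hull_affine_independent[OF vertices_independent[OF assms(1)]] by blast
  have "c \<subseteq> vertices K'"
  proof
    fix i assume i: "i \<in> c"
    then have "i \<in> K'" using c(2) by (metis IntD2 hull_inc)
    moreover have "i \<in> nodes" using i c(1) assms by (auto simp: nodes_def)
    ultimately show "i \<in> vertices K'" using vertices_if_node assms by blast
  qed
  then have "K \<inter> K' \<subseteq> convex hull (vertices K \<inter> vertices K')"
    unfolding c(2) using c(1) by (intro hull_mono) auto
  moreover have "convex hull (vertices K \<inter> vertices K') \<subseteq> K \<inter> K'"
    using hull_mono[of "vertices K \<inter> vertices K'" "vertices K" convex]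
      hull_mono[of "vertices K \<inter> vertices K'" "vertices K'" convex]
      hull_vertices[OF assms(1)] hull_vertices[OF assms(2)] by auto
  ultimately show ?thesis by blast
qed

text \<open>The intersection is a proper face of at least one of two distinct elements, and a proper
  face has smaller dimension.\<close>

lemma negligible_mesh_Int:
  assumes "K \<in> \<T>" "K' \<in> \<T>" "K \<noteq> K'"
  shows "negligible (K \<inter> K')"
proof -
  have lt: "aff_dim (K \<inter> K') < aff_dim K" if "K \<inter> K' \<noteq> K"
    using face_of_aff_dim_lt[OF convex_mesh mesh_face that] assms by auto
  have "aff_dim (K \<inter> K') < aff_dim K'" if "K \<inter> K' \<noteq> K'"
    using face_of_aff_dim_lt[OF convex_mesh, of K' "K' \<inter> K"] mesh_face[of K' K] that assms
    by (auto simp: Int_commute)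
  then have "aff_dim (K \<inter> K') < int DIM(real ^ 'd)"
    using lt assms aff_dim_mesh by fastforce
  then have "interior (K \<inter> K') = {}"
    using aff_dim_nonempty_interior[of "K \<inter> K'"] by auto
  then show ?thesis
    using negligible_convex_interior convex_Int convex_mesh assms by blast
qed

lemma interior_mesh_nonempty:
  assumes "K \<in> \<T>"
  shows "interior K \<noteq> {}"
proof -
  have "K \<noteq> {}" using aff_dim_mesh[OF assms] by auto
  then show ?thesis
    using aff_dim_mesh[OF assms] rel_interior_eq_empty[OF convex_mesh[OF assms]]
    by (simp add: interior_rel_interior_gen)
qed

lemma measure_mesh_pos: "K \<in> \<T> \<Longrightarrow> 0 < measure lebesgue K"
  using interior_mesh_nonempty negligible_convex_interior[OF convex_mesh, of K]
    lmeasurable_compact[OF compact_mesh, of K]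
  by (metis measure_nonneg negligible_iff_measure0 order_less_le)

lemma negligible_frontier: "negligible (frontier \<Omega>)"
  using negligible_frontier_lipschitz_domain[OF domain(4) finite_mesh convex_mesh Union_mesh] by blast

lemma open_domain: "open \<Omega>"
  using domain(5) by (simp add: polyhedral_domain_def)

lemma negligible_closure_diff: "negligible (closure \<Omega> - \<Omega>)"
  using negligible_frontier open_domain by (simp add: frontier_def interior_open)

lemma compact_closure: "compact (closure \<Omega>)"
  using domain(2) by (simp add: compact_closure)

lemma nodes_nonempty: "nodes \<noteq> {}"
proof -
  have "\<T> \<noteq> {}" using Union_mesh domain(1) closure_subset[of \<Omega>] by auto
  then obtain K where "K \<in> \<T>" by blast
  then show ?thesis
    using interior_mesh_nonempty hull_vertices by (force simp: nodes_def)
qed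

section \<open>The finite element space and its nodal basis\<close>

lemma X_h_affine: "u \<in> X_h \<Longrightarrow> K \<in> \<T> \<Longrightarrow> \<exists>a b. \<forall>x\<in>K. u x = a \<bullet> x + b"
  by (simp add: X_h_def)

text \<open>An affine function on a simplex is determined by its vertex values; outside the closure
  both functions are 0.\<close>

lemma X_h_eqI:
  assumes "u \<in> X_h" "v \<in> X_h" "\<And>i. i \<in> nodes \<Longrightarrow> u i = v i"
  shows "u = v"
proof
  fix x
  show "u x = v x"
  proof (cases "x \<in> closure \<Omega>")
    case True
    then obtain K where K: "K \<in> \<T>" "x \<in> K" using Union_mesh by blast
    obtain a b where a: "\<And>x. x \<in> K \<Longrightarrow> u x = a \<bullet> x + b"
      using X_h_affine[OF assms(1) K(1)] by blast
    obtain a' b' where a': "\<And>x. x \<in> K \<Longrightarrow> v x = a' \<bullet> x + b'"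
      using X_h_affine[OF assms(2) K(1)] by blast
    have "a \<bullet> x + b = a' \<bullet> x + b'"
    proof (rule affine_eq_on_convex_hull)
      show "a \<bullet> w + b = a' \<bullet> w + b'" if "w \<in> vertices K" for w
      proof -
        have "w \<in> K" "w \<in> nodes" using that vertices_subset[of K] K(1) by (auto simp: nodes_def)
        then show ?thesis using a[of w] a'[of w] assms(3)[of w] by simp
      qed
    qed (use K hull_vertices in simp)
    then show ?thesis using a a' K by simp
  qed (use assms in \<open>simp add: X_h_def\<close>)
qed

lemma ex_nodal_interpolant:
  "\<exists>u\<in>X_h. \<forall>i\<in>nodes. u i = g i"
proof -
  have "\<exists>a b. \<forall>v\<in>vertices K. a \<bullet> v + b = g v" if "K \<in> \<T>" for K
    using affine_independent_interpolation[OF vertices_independent[OF that]] .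
  then obtain A B where AB: "\<And>K v. K \<in> \<T> \<Longrightarrow> v \<in> vertices K \<Longrightarrow> A K \<bullet> v + B K = g v"
    by metis
  \<comment> \<open>An arbitrary element containing \<open>x\<close> is used. The next fact shows
    that every such element gives the same value, since common faces are spanned by common
    vertices.\<close>
  define u where "u x = (if x \<in> closure \<Omega> then let K = (SOME K. K \<in> \<T> \<and> x \<in> K) in A K \<bullet> x + B K else 0)" for x
  have u: "u x = A K \<bullet> x + B K" if K: "K \<in> \<T>" "x \<in> K" for K x
  proof -
    define K' where "K' = (SOME K. K \<in> \<T> \<and> x \<in> K)"
    have K': "K' \<in> \<T> \<and> x \<in> K'"
      unfolding K'_def by (rule someI[of _ K]) (use K in auto)
    have "A K' \<bullet> x + B K' = A K \<bullet> x + B K"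
    proof (rule affine_eq_on_convex_hull)
      show "x \<in> convex hull (vertices K \<inter> vertices K')"
        using K K' mesh_Int by blast
    qed (use AB K K' in auto)
    moreover have "x \<in> closure \<Omega>" using K mesh_subset by auto
    ultimately show ?thesis by (simp add: u_def K'_def Let_def)
  qed
  have "continuous_on (\<Union>K\<in>\<T>. K) u"
  proof (rule continuous_on_closed_Union[OF finite_mesh])
    show "continuous_on K u" if "K \<in> \<T>" for K
      by (rule continuous_on_eq[of _ "\<lambda>x. A K \<bullet> x + B K"]) (auto intro!: continuous_intros simp: u[OF that])
  qed (use compact_mesh compact_imp_closed in blast)
  then have "u \<in> X_h"
    using u Union_mesh by (auto simp: X_h_def u_def)
  moreover have "u i = g i" if "i \<in> nodes" for i
    using that u AB vertices_subset by (fastforce simp: nodes_def)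
  ultimately show ?thesis by blast
qed

lemma
  shows basis_fun_in: "basis_fun i \<in> X_h"
    and basis_fun_node: "j \<in> nodes \<Longrightarrow> basis_fun i j = (if j = i then 1 else 0)"
proof -
  have "\<exists>!u. u \<in> X_h \<and> (\<forall>j\<in>nodes. u j = (if j = i then 1 else 0))"
    using ex_nodal_interpolant[of "\<lambda>j. if j = i then 1 else 0"] X_h_eqI by (metis (full_types))
  from theI'[OF this] show "basis_fun i \<in> X_h"
    "j \<in> nodes \<Longrightarrow> basis_fun i j = (if j = i then 1 else 0)"
    unfolding basis_fun_def by auto
qed

lemma X_h_add:
  assumes "u \<in> X_h" "v \<in> X_h"
  shows "(\<lambda>x. u x + r * v x) \<in> X_h"
proof -
  have "\<exists>a b. \<forall>x\<in>K. u x + r * v x = a \<bullet> x + b" if K: "K \<in> \<T>" for K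
  proof -
    obtain a b where a: "\<And>x. x \<in> K \<Longrightarrow> u x = a \<bullet> x + b"
      using X_h_affine[OF assms(1) K] by blast
    obtain a' b' where a': "\<And>x. x \<in> K \<Longrightarrow> v x = a' \<bullet> x + b'"
      using X_h_affine[OF assms(2) K] by blast
    have "\<forall>x\<in>K. u x + r * v x = (a + r *\<^sub>R a') \<bullet> x + (b + r * b')"
      using a a' by (simp add: inner_add_left algebra_simps)
    then show ?thesis by blast
  qed
  then show ?thesis using assms unfolding X_h_def
    by (auto intro!: continuous_intros)
qed

lemma X_h_0: "(\<lambda>_. 0) \<in> X_h"
  unfolding X_h_def by (auto intro!: exI[of _ 0])

lemma I_h_in: "I_h g \<in> X_h"
proof -
  have "(\<lambda>x. \<Sum>i\<in>J. g i * basis_fun i x) \<in> X_h" if "finite J" for J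
    using that
  proof induction
    case (insert i J)
    then show ?case
      using X_h_add[OF insert.IH basis_fun_in, of "g i" i] by (simp add: add.commute)
  qed (simp add: X_h_0)
  from this[OF finite_nodes] show ?thesis by (simp add: I_h_def[abs_def])
qed

lemma I_h_node: "i \<in> nodes \<Longrightarrow> I_h g i = g i"
  unfolding I_h_def using finite_nodes
  by (simp add: basis_fun_node if_distrib cong: if_cong)

section \<open>Integrals of finite element functions and nodal masses\<close>

lemma set_integrable_closure:
  fixes w :: "real ^ 'd \<Rightarrow> real"
  assumes "continuous_on (closure \<Omega>) w"
  shows "set_integrable lebesgue (closure \<Omega>) w"
proof -
  have "set_integrable lborel (closure \<Omega>) w"
    unfolding set_integrable_def by (intro borel_integrable_compact compact_closure assms)
  then show ?thesis
    unfolding set_integrable_def by (subst integrable_completion) (auto dest: borel_measurable_integrable)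
qed

lemma set_integrable_X_h: "u \<in> X_h \<Longrightarrow> set_integrable lebesgue (closure \<Omega>) u"
  by (rule set_integrable_closure) (simp add: X_h_def)

lemma measure_patch:
  "measure lebesgue (patch i) = (\<Sum>K | K \<in> \<T> \<and> i \<in> K. measure lebesgue K)"
  unfolding patch_def
proof (rule measure_negligible_finite_Union)
  show "pairwise (\<lambda>S T. negligible (S \<inter> T)) {K \<in> \<T>. i \<in> K}"
    using negligible_mesh_Int by (auto simp: pairwise_def)
qed (use finite_mesh lmeasurable_compact[OF compact_mesh] in auto)

lemma m_pos: "i \<in> nodes \<Longrightarrow> 0 < m i"
  unfolding m_def measure_patch nodes_def
  using finite_mesh vertices_subset measure_mesh_pos
  by (intro divide_pos_pos sum_pos) auto

lemma m_\<phi>_pos: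
  assumes "i \<in> nodes"
  shows "0 < m_\<phi> i"
proof -
  have pos: "0 < \<phi>_on K" if K: "K \<in> \<T>" for K
  proof -
    obtain a where a: "\<And>x. x \<in> interior K \<Longrightarrow> \<phi> x = a" using porosity_mesh[OF K] by blast
    obtain y where y: "y \<in> interior K" using interior_mesh_nonempty[OF K] by blast
    have "\<phi>_on K = a" unfolding \<phi>_on_def
      by (rule the_equality) (use a y in auto)
    \<comment> \<open>The porosity bounds are given on \<Omega> only; a nonempty open set inside the
      closure must meet \<Omega>.\<close>
    moreover have "interior K \<inter> \<Omega> \<noteq> {}"
      using y mesh_subset[OF K] interior_subset[of K] open_Int_closure_eq_empty[of "interior K" \<Omega>]
      by (auto simp: open_interior)
    ultimately show ?thesis using a porosity_bounds by fastforce
  qed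
  have "{K. K \<in> \<T> \<and> i \<in> K} \<noteq> {}"
    using assms vertices_subset by (auto simp: nodes_def)
  then show ?thesis
    unfolding m_\<phi>_def
    using finite_mesh pos measure_mesh_pos by (intro divide_pos_pos sum_pos mult_pos_pos) auto
qed

text \<open>The vertex rule is exact on each element, and elements overlap in null sets only.
  Regrouping the contributions by node produces the masses \<open>m i\<close>.\<close>

lemma integral_X_h:
  assumes u: "u \<in> X_h"
  shows "(LINT x:\<Omega>|lebesgue. u x) = (\<Sum>i\<in>nodes. m i * u i)"
proof -
  let ?d = "real CARD('d) + 1"
  have "(LINT x:\<Omega>|lebesgue. u x) = (LINT x:(\<Union>K\<in>\<T>. K)|lebesgue. u x)"
    using set_integral_lebesgue_spike[of \<Omega> "closure \<Omega>" u] negligible_closure_diff closure_subset[of \<Omega>]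
    by (simp add: Union_mesh Diff_eq_empty_iff[THEN iffD2])
  also have "\<dots> = (\<Sum>K\<in>\<T>. LINT x:K|lebesgue. u x)"
  proof (rule set_integral_finite_UN_AE[OF finite_mesh])
    show "K \<in> sets lebesgue" if "K \<in> \<T>" for K
      using lmeasurable_compact[OF compact_mesh[OF that]] by auto
    show "set_integrable lebesgue K u" if "K \<in> \<T>" for K
      by (rule set_integrable_subset[OF set_integrable_X_h[OF u]])
        (use that mesh_subset lmeasurable_compact[OF compact_mesh[OF that]] in auto)
    show "AE x in lebesgue. x \<in> K \<and> x \<in> K' \<longrightarrow> K = K'" if "K \<in> \<T>" "K' \<in> \<T>" for K K'
    proof (cases "K = K'")
      case False
      have "K \<inter> K' \<in> null_sets lebesgue"
        using negligible_mesh_Int[OF that False] by (simp add: negligible_iff_null_sets)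
      from AE_not_in[OF this] show ?thesis by eventually_elim auto
    qed simp
  qed
  also have "\<dots> = (\<Sum>K\<in>\<T>. \<Sum>i\<in>vertices K. measure lebesgue K / ?d * u i)"
  proof (rule sum.cong)
    fix K assume K: "K \<in> \<T>"
    obtain a b where a: "\<And>x. x \<in> K \<Longrightarrow> u x = a \<bullet> x + b"
      using X_h_affine[OF u K] by blast
    show "(LINT x:K|lebesgue. u x) = (\<Sum>i\<in>vertices K. measure lebesgue K / ?d * u i)"
      using integral_affine_simplex[OF vertices_independent[OF K], of u a b] a
      by (simp add: hull_vertices[OF K] sum_distrib_left add.commute)
  qed simp
  also have "\<dots> = (\<Sum>K\<in>\<T>. \<Sum>i\<in>nodes. if i \<in> K then measure lebesgue K / ?d * u i else 0)"
  proof (rule sum.cong)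
    fix K assume K: "K \<in> \<T>"
    have "vertices K = {i \<in> nodes. i \<in> K}"
      using vertices_if_node[OF _ K] vertices_subset[of K] K by (auto simp: nodes_def)
    then show "(\<Sum>i\<in>vertices K. measure lebesgue K / ?d * u i) =
        (\<Sum>i\<in>nodes. if i \<in> K then measure lebesgue K / ?d * u i else 0)"
      by (simp only: sum.inter_filter[OF finite_nodes])
  qed simp
  also have "\<dots> = (\<Sum>i\<in>nodes. \<Sum>K\<in>\<T>. if i \<in> K then measure lebesgue K / ?d * u i else 0)"
    by (rule sum.swap)
  also have "\<dots> = (\<Sum>i\<in>nodes. m i * u i)"
    using finite_mesh
    by (simp add: m_def measure_patch sum_divide_distrib sum_distrib_right flip: sum.inter_filter)
  finally show ?thesis .
qed

text \<open>Integrate the constant 1, which appears in \<open>X_h\<close> as the indicator of the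
  closure because its members vanish outside.\<close>

lemma sum_m: "(\<Sum>i\<in>nodes. m i) = measure lebesgue \<Omega>"
proof -
  have "\<exists>a b. \<forall>x\<in>K. indicat_real (closure \<Omega>) x = a \<bullet> x + b" if "K \<in> \<T>" for K
    using mesh_subset[OF that] by (intro exI[of _ 0] exI[of _ 1]) auto
  then have "indicat_real (closure \<Omega>) \<in> X_h"
    by (auto simp: X_h_def intro!: continuous_on_eq[OF continuous_on_const[of _ 1]])
  from integral_X_h[OF this]
  have "(\<Sum>i\<in>nodes. m i) = (LINT x:\<Omega>|lebesgue. indicat_real (closure \<Omega>) x)"
    using nodes_subset by (simp add: indicator_def subset_iff cong: sum.cong)
  also have "\<dots> = (LINT x|lebesgue. indicat_real \<Omega> x)"
    unfolding set_lebesgue_integral_def using closure_subset[of \<Omega>]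
    by (intro Bochner_Integration.integral_cong) (auto simp: indicator_def)
  finally show ?thesis using open_domain by (simp add: borel_open)
qed

end

section \<open>Balance of the discrete sources\<close>

text \<open>Lebesgue measure is complete, so changing a function on a null set also preserves
  measurability.\<close>

lemma
  fixes f g :: "'a::euclidean_space \<Rightarrow> real"
  assumes "AE x in lebesgue. f x = g x"
  shows integrable_lebesgue_cong_AE: "integrable lebesgue f \<longleftrightarrow> integrable lebesgue g"
    and integral_lebesgue_cong_AE: "integral\<^sup>L lebesgue f = integral\<^sup>L lebesgue g"
proof -
  obtain N where N: "N \<in> null_sets lebesgue" "{x. f x \<noteq> g x} \<subseteq> N"
    using assms unfolding eventually_ae_filter by auto
  then have neg: "negligible N" by (simp add: negligible_iff_null_sets)
  have eq: "f x = g x" if "x \<in> UNIV - N" for x using N that by auto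
  show *: "integrable lebesgue f \<longleftrightarrow> integrable lebesgue g"
    using absolutely_integrable_spike_eq[OF neg, of UNIV g f] eq by (simp add: set_integrable_def)
  show "integral\<^sup>L lebesgue f = integral\<^sup>L lebesgue g"
  proof (cases "integrable lebesgue f")
    case True
    then have "set_integrable lebesgue UNIV f" "set_integrable lebesgue UNIV g"
      using * by (simp_all add: set_integrable_def)
    from this[THEN set_lebesgue_integral_eq_integral(2)] integral_spike[OF neg, of UNIV f g] eq
    show ?thesis by (simp add: set_lebesgue_integral_def)
  next
    case False
    with * show ?thesis by (simp add: not_integrable_integral_eq)
  qed
qed

text \<open>Fubini for the completed measure, which is not the product of the completed factors:
  \<open>f\<close> is replaced by a Borel representative \<open>g\<close>, and the results are
  carried back on almost every section.\<close>

lemma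
  fixes f :: "'a::euclidean_space \<times> 'b::euclidean_space \<Rightarrow> real"
  assumes f: "integrable lebesgue f"
  shows AE_integrable_lebesgue_section: "AE t in lebesgue. integrable lebesgue (\<lambda>x. f (x, t))"
    and integrable_lebesgue_section_integral: "integrable lebesgue (\<lambda>t. LINT x|lebesgue. f (x, t))"
proof -
  obtain g where g [measurable]: "g \<in> borel_measurable lborel" and ae: "AE z in lborel. f z = g z"
    using completion_ex_borel_measurable_real[of f lborel] f by auto
  have gi: "integrable lborel g"
    using f integrable_lebesgue_cong_AE[of f g] AE_completion[OF ae]
    by (simp add: integrable_completion)
  \<comment> \<open>Swapping the arguments makes \<open>t\<close> the outer variable.\<close>
  define h where "h = (\<lambda>(t, x). g (x, t))"
  have "integrable (lborel \<Otimes>\<^sub>M lborel) h"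
    using lborel_pair.integrable_product_swap[of g] gi by (simp add: h_def lborel_prod)
  note 1 = lborel_pair.AE_integrable_fst'[OF this] lborel_pair.integrable_fst'[OF this]
  \<comment> \<open>A Borel null set containing all points where \<open>f\<close> and
    \<open>g\<close> differ; for almost every \<open>t\<close> its section is null, so the sections
    of \<open>f\<close> and \<open>g\<close> agree almost everywhere.\<close>
  obtain N where N: "N \<in> null_sets lborel" "{z. f z \<noteq> g z} \<subseteq> N"
    using ae unfolding eventually_ae_filter by auto
  then have [measurable]: "N \<in> sets (lborel \<Otimes>\<^sub>M lborel)" unfolding lborel_prod by auto
  have "AE z in lborel \<Otimes>\<^sub>M lborel. z \<notin> N"
    unfolding lborel_prod by (rule AE_not_in[OF N(1)])
  then have "AE x in lborel. AE t in lborel. (x, t) \<notin> N"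
    by (rule lborel_pair.AE_pair)
  then have "AE t in lborel. AE x in lborel. (x, t) \<notin> N"
  proof (subst (asm) lborel_pair.AE_commute)
    have "{z \<in> space (lborel \<Otimes>\<^sub>M lborel). (fst z, snd z) \<notin> N} = space (lborel \<Otimes>\<^sub>M lborel) - N"
      by auto
    then show "{z \<in> space (lborel \<Otimes>\<^sub>M lborel). (fst z, snd z) \<notin> N} \<in> sets (lborel \<Otimes>\<^sub>M lborel)"
      using \<open>N \<in> sets (lborel \<Otimes>\<^sub>M lborel)\<close> by (metis sets.compl_sets)
  qed
  then have 2: "AE t in lborel. AE x in lebesgue. f (x, t) = g (x, t)"
  proof eventually_elim
    case (elim t)
    then have "AE x in lborel. f (x, t) = g (x, t)"
      by eventually_elim (use N(2) in blast)
    then show ?case by (rule AE_completion)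
  qed
  have sec: "(\<lambda>x. g (x, t)) \<in> borel_measurable lborel" for t by simp
  from 1(1) 2 have "AE t in lborel. integrable lebesgue (\<lambda>x. f (x, t))"
  proof eventually_elim
    case (elim t)
    then show ?case
      using integrable_completion[OF sec[of t]] integrable_lebesgue_cong_AE[OF elim(2)]
      by (simp add: h_def)
  qed
  then show "AE t in lebesgue. integrable lebesgue (\<lambda>x. f (x, t))" by (rule AE_completion)
  have "AE t in lborel. (LINT x|lebesgue. f (x, t)) = (LINT x|lborel. h (t, x))"
    using 2
  proof eventually_elim
    case (elim t)
    show ?case
      using integral_completion[OF sec[of t]] integral_lebesgue_cong_AE[OF elim] by (simp add: h_def)
  qed
  from integrable_lebesgue_cong_AE[OF AE_completion[OF this]] 1(2)
  show "integrable lebesgue (\<lambda>t. LINT x|lebesgue. f (x, t))"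
    by (subst integrable_completion[symmetric]) (simp_all add: integrable_completion)
qed

text \<open>On a bounded set square integrability gives integrability, through the majorant
  \<open>1 + (q x t)\<^sup>2\<close>; Fubini is then applied to the restriction to \<open>A\<close>.
  The set \<open>A\<close> will be \<Omega> or the part of a patch inside \<Omega>.\<close>

lemma
  fixes q :: "'a::euclidean_space \<Rightarrow> 'b::euclidean_space \<Rightarrow> real"
  assumes q: "square_integrable_on (\<lambda>(x, t). q x t) (\<Omega> \<times> J)"
    and \<Omega>: "open \<Omega>" "bounded \<Omega>" and J: "open J" "bounded J"
    and A: "A \<in> sets borel" "A \<subseteq> \<Omega>"
  shows AE_set_integrable_section: "AE t in lebesgue. t \<in> J \<longrightarrow> set_integrable lebesgue A (\<lambda>x. q x t)"
    and set_integrable_section_integral: "set_integrable lebesgue J (\<lambda>t. LINT x:A|lebesgue. q x t)"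
proof -
  let ?Q = "\<Omega> \<times> J" and ?q = "\<lambda>(x, t). q x t"
  have Q: "?Q \<in> lmeasurable"
    using \<Omega> J by (intro lmeasurable_open bounded_Times open_Times)
  have "finite_measure (lebesgue_on ?Q)"
    using Q by (simp add: finite_measure_lebesgue_on)
  then have "integrable (lebesgue_on ?Q) (\<lambda>z. 1 + (?q z)\<^sup>2)"
    using q by (intro Bochner_Integration.integrable_add finite_measure.integrable_const)
      (auto simp: square_integrable_on_def)
  then have "integrable (lebesgue_on ?Q) ?q"
  proof (rule Bochner_Integration.integrable_bound)
    show "?q \<in> borel_measurable (lebesgue_on ?Q)"
      using q by (simp add: square_integrable_on_def)
    have "\<bar>r\<bar> \<le> 1 + r\<^sup>2" for r :: real
      using zero_le_power2[of "\<bar>r\<bar> - 1"] by (simp add: power2_eq_square algebra_simps)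
    then show "AE z in lebesgue_on ?Q. norm (?q z) \<le> norm (1 + (?q z)\<^sup>2)"
      by (intro AE_I2) (simp add: order.trans[OF _ abs_ge_self])
  qed
  then have "integrable lebesgue (\<lambda>z. indicator ?Q z * ?q z)"
    using Q by (subst (asm) integrable_restrict_space) auto
  then have "integrable lebesgue (\<lambda>z. indicator (A \<times> UNIV) z * (indicator ?Q z * ?q z))"
  proof (rule Bochner_Integration.integrable_bound)
    have "A \<times> (UNIV :: 'b set) \<in> sets (lborel \<Otimes>\<^sub>M lborel)" using A by auto
    then have "A \<times> (UNIV :: 'b set) \<in> sets lebesgue" unfolding lborel_prod by auto
    then show "(\<lambda>z. indicator (A \<times> UNIV) z * (indicator ?Q z * ?q z)) \<in> borel_measurable lebesgue"
      by (intro borel_measurable_times[OF borel_measurable_indicator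
            borel_measurable_integrable[OF \<open>integrable lebesgue (\<lambda>z. indicator ?Q z * ?q z)\<close>]])
  qed (auto simp: indicator_def)
  note 1 = AE_integrable_lebesgue_section[OF this] integrable_lebesgue_section_integral[OF this]
  have eq: "indicator (A \<times> UNIV) (x, t) * (indicator ?Q (x, t) * q x t) =
      indicator J t * (indicator A x * q x t)" for x t
    using A(2) by (auto simp: indicator_def)
  show "AE t in lebesgue. t \<in> J \<longrightarrow> set_integrable lebesgue A (\<lambda>x. q x t)"
    using 1(1) by eventually_elim (auto simp: eq set_integrable_def)
  show "set_integrable lebesgue J (\<lambda>t. LINT x:A|lebesgue. q x t)"
    using 1(2) by (simp add: eq set_integrable_def set_lebesgue_integral_def)
qed

context two_phase_step
begin

section \<open>Time averages and conservation of the total source\<close>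

lemma \<tau>_pos: "\<tau> > 0"
  using T_pos step by (simp add: \<tau>_def)

lemma time_interval: "{(real n - 1) * \<tau><..real n * \<tau>} \<subseteq> {0<..T}"
proof -
  have "real n * \<tau> \<le> T" using T_pos step by (simp add: \<tau>_def field_simps)
  moreover have "0 \<le> (real n - 1) * \<tau>" using \<tau>_pos step by simp
  ultimately show ?thesis by auto
qed

text \<open>For \<open>n = N\<close> the half-open step interval contains \<open>T\<close>, whereas
  the data are controlled on the open interval; the single point is null.\<close>

lemma AE_time_interval:
  "AE t in lebesgue. t \<in> {(real n - 1) * \<tau><..real n * \<tau>} \<longrightarrow> t \<in> {0<..<T}"
proof -
  have "AE t in lebesgue. t \<noteq> T"
    by (rule AE_completion[OF AE_lborel_singleton])
  then show ?thesis
  proof eventually_elim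
    case (elim t)
    then show ?case using subsetD[OF time_interval, of t] by auto
  qed
qed

lemma set_integrable_time_interval:
  fixes g :: "real \<Rightarrow> real"
  assumes "set_integrable lebesgue {0<..<T} g"
  shows "set_integrable lebesgue {(real n - 1) * \<tau><..real n * \<tau>} g"
proof -
  have "set_integrable lebesgue {0<..T} g"
    using assms
    by (subst set_integrable_lebesgue_spike[where A = "{0<..T}" and B = "{0<..<T}"])
      (auto intro: negligible_subset[of "{T}"])
  then show ?thesis
    by (rule set_integrable_subset) (use time_interval in auto)
qed

lemma time_avg_cong:
  assumes "AE t in lebesgue. t \<in> {0<..<T} \<longrightarrow> f t = g t"
  shows "time_avg f = time_avg g"
proof -
  have "AE t in lebesgue. indicator {(real n - 1) * \<tau><..real n * \<tau>} t * f t =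
      indicator {(real n - 1) * \<tau><..real n * \<tau>} t * g t"
    using assms AE_time_interval by eventually_elim (auto simp: indicator_def)
  from integral_lebesgue_cong_AE[OF this] show ?thesis
    by (simp add: time_avg_def set_lebesgue_integral_def)
qed

lemma sum_m_pos: "0 < (\<Sum>i\<in>nodes. m i)"
  using nodes_nonempty finite_nodes m_pos by (intro sum_pos) auto

lemma patch_in_borel: "patch i \<in> sets borel"
  unfolding patch_def using finite_mesh compact_mesh
  by (intro sets.finite_Union) (auto intro: borel_compact)

text \<open>A patch is closed and may touch the boundary, where the data are not controlled; the
  boundary is null.\<close>

lemma integral_patch:
  fixes f :: "real ^ 'd \<Rightarrow> real"
  shows "(LINT y:patch i|lebesgue. f y) = (LINT y:patch i \<inter> \<Omega>|lebesgue. f y)"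
proof (rule set_integral_lebesgue_spike)
  have "patch i - patch i \<inter> \<Omega> \<subseteq> closure \<Omega> - \<Omega>"
    using mesh_subset by (auto simp: patch_def)
  then show "negligible (patch i - patch i \<inter> \<Omega>)"
    using negligible_closure_diff negligible_subset by blast
qed simp

text \<open>Integrability of \<open>f\<close> splits the integral defining the correction, and
  \<open>integral_X_h\<close> expresses its discrete part by nodal masses.\<close>

lemma r_h_balanced_node:
  assumes f: "set_integrable lebesgue \<Omega> f" and i: "i \<in> nodes"
  shows "r_h_balanced f i = r_h f i - ((\<Sum>j\<in>nodes. m j * r_h f j) - (LINT x:\<Omega>|lebesgue. f x)) / measure lebesgue \<Omega>"
proof -
  have "r_h f \<in> X_h" unfolding r_h_def by (rule I_h_in)
  moreover from this have "set_integrable lebesgue \<Omega> (r_h f)"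
    by (intro set_integrable_subset[OF set_integrable_X_h]) (use open_domain closure_subset in \<open>auto simp: borel_open\<close>)
  ultimately have "(LINT y:\<Omega>|lebesgue. r_h f y - f y) = (\<Sum>j\<in>nodes. m j * r_h f j) - (LINT x:\<Omega>|lebesgue. f x)"
    using f by (simp add: set_integral_diff integral_X_h)
  then show ?thesis using i nodes_subset by (auto simp: r_h_balanced_def)
qed

text \<open>The correction is constant in space and the masses add up to the volume of \<Omega>, so
  at almost every time the lumped total equals the exact one. Averaging in time commutes with the
  finite sum.\<close>

lemma sum_m_time_avg_r_h_balanced:
  assumes q: "square_integrable_on (\<lambda>(x, t). q x t) (\<Omega> \<times> {0<..<T})"
  shows "(\<Sum>i\<in>nodes. m i * time_avg (\<lambda>t. r_h_balanced (\<lambda>y. q y t) i)) = time_avg (\<lambda>t. LINT x:\<Omega>|lebesgue. q x t)"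
proof -
  let ?I = "{(real n - 1) * \<tau><..real n * \<tau>}"
  note sec = set_integrable_section_integral[OF q open_domain domain(2)]
  define J where "J t = (LINT x:\<Omega>|lebesgue. q x t)" for t
  define v where "v i t = r_h (\<lambda>y. q y t) i" for i t
  have J: "set_integrable lebesgue ?I J"
    unfolding J_def using sec[of \<Omega>] open_domain by (intro set_integrable_time_interval) (auto simp: borel_open)
  have v: "set_integrable lebesgue ?I (v i)" if "i \<in> nodes" for i
  proof -
    have eq: "v i = (\<lambda>t. (LINT x:patch i \<inter> \<Omega>|lebesgue. q x t) / measure lebesgue (patch i))"
      using that by (simp add: fun_eq_iff v_def r_h_def I_h_node integral_patch)
    show ?thesis
      unfolding eq using sec[of "patch i \<inter> \<Omega>"] patch_in_borel open_domain
      by (intro set_integrable_time_interval set_integrable_divide) (auto simp: borel_open)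
  qed
  \<comment> \<open>The constant subtracted at time \<open>t\<close>: the mean excess of the
    discrete integral over the exact one.\<close>
  define w where "w t = ((\<Sum>j\<in>nodes. m j * v j t) - J t) / measure lebesgue \<Omega>" for t
  have w: "set_integrable lebesgue ?I w"
    unfolding w_def[abs_def] using finite_nodes v J
    by (intro set_integrable_divide set_integral_diff absolutely_integrable_sum set_integrable_mult_right) auto
  \<comment> \<open>The nodal formula is available only at times where the section of
    \<open>q\<close> is integrable, that is, almost everywhere.\<close>
  have avg: "time_avg (\<lambda>t. r_h_balanced (\<lambda>y. q y t) i) = time_avg (\<lambda>t. v i t - w t)" if i: "i \<in> nodes" for i
  proof (rule time_avg_cong)
    show "AE t in lebesgue. t \<in> {0<..<T} \<longrightarrow> r_h_balanced (\<lambda>y. q y t) i = v i t - w t"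
    proof -
      have "AE t in lebesgue. t \<in> {0<..<T} \<longrightarrow> set_integrable lebesgue \<Omega> (\<lambda>x. q x t)"
        using AE_set_integrable_section[OF q open_domain domain(2), of \<Omega>] open_domain by (simp add: borel_open)
      then show ?thesis
        by eventually_elim (auto simp: r_h_balanced_node[OF _ i] v_def w_def J_def)
    qed
  qed
  have "(\<Sum>i\<in>nodes. m i * time_avg (\<lambda>t. r_h_balanced (\<lambda>y. q y t) i)) =
      (\<Sum>i\<in>nodes. m i * time_avg (\<lambda>t. v i t - w t))"
    by (simp add: avg)
  also have "\<dots> = (\<Sum>i\<in>nodes. LINT t:?I|lebesgue. m i * (v i t - w t)) / \<tau>"
    by (simp add: time_avg_def sum_divide_distrib)
  also have "(\<Sum>i\<in>nodes. LINT t:?I|lebesgue. m i * (v i t - w t)) =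
      (LINT t:?I|lebesgue. (\<Sum>i\<in>nodes. m i * (v i t - w t)))"
  proof -
    have "set_integrable lebesgue ?I (\<lambda>t. m i * (v i t - w t))" if "i \<in> nodes" for i
      using v[OF that] w by (intro set_integrable_mult_right set_integral_diff)
    then show ?thesis
      unfolding set_lebesgue_integral_def set_integrable_def
      unfolding scaleR_sum_right by (intro Bochner_Integration.integral_sum[symmetric])
  qed
  also have "(\<lambda>t. \<Sum>i\<in>nodes. m i * (v i t - w t)) = J"
  proof
    fix t
    have "(\<Sum>i\<in>nodes. m i * (v i t - w t)) = (\<Sum>i\<in>nodes. m i * v i t) - measure lebesgue \<Omega> * w t"
      by (simp add: right_diff_distrib sum_subtractf sum_m flip: sum_distrib_right)
    then show "(\<Sum>i\<in>nodes. m i * (v i t - w t)) = J t"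
      using sum_m_pos by (simp add: w_def sum_m)
  qed
  finally show ?thesis by (simp add: time_avg_def J_def[abs_def])
qed

lemma source_balance: "(\<Sum>i\<in>nodes. m i * qI_h i) = (\<Sum>i\<in>nodes. m i * qO_h i)"
proof -
  have "AE t in lebesgue. t \<in> {0<..<T} \<longrightarrow> (LINT x:\<Omega>|lebesgue. qI x t) = (LINT x:\<Omega>|lebesgue. qO x t)"
    using q_balance by (subst (asm) AE_restrict_space_iff) auto
  from time_avg_cong[OF this] show ?thesis
    unfolding qI_h_def qO_h_def using q_L2 by (simp add: sum_m_time_avg_r_h_balanced)
qed

end

section \<open>Solvability of the time step\<close>

lemma sum_antisym_eq_0:
  fixes h :: "'a \<Rightarrow> 'a \<Rightarrow> real"
  assumes "\<And>i j. i \<in> I \<Longrightarrow> j \<in> I \<Longrightarrow> h i j = - h j i"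
  shows "(\<Sum>i\<in>I. \<Sum>j\<in>I. h i j) = 0"
proof -
  have "(\<Sum>i\<in>I. \<Sum>j\<in>I. h i j) = (\<Sum>i\<in>I. \<Sum>j\<in>I. - h j i)"
    by (intro sum.cong refl assms)
  also have "\<dots> = - (\<Sum>i\<in>I. \<Sum>j\<in>I. h i j)"
    by (subst sum.swap) (simp add: sum_negf)
  finally show ?thesis by simp
qed

text \<open>Adding the sum with \<open>i\<close> and \<open>j\<close> exchanged gives the weighted
  sum of the squares of \<open>l i - l j\<close>.\<close>

lemma sum_symmetric_nonneg:
  fixes w :: "'a \<Rightarrow> 'a \<Rightarrow> real"
  assumes w: "\<And>i j. w i j = w j i" "\<And>i j. 0 \<le> w i j"
  shows "0 \<le> (\<Sum>i\<in>I. \<Sum>j\<in>I. l i * (w i j * (l i - l j)))"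
proof -
  let ?Q = "\<Sum>i\<in>I. \<Sum>j\<in>I. l i * (w i j * (l i - l j))"
  have "?Q = (\<Sum>i\<in>I. \<Sum>j\<in>I. l j * (w i j * (l j - l i)))"
    by (subst sum.swap) (simp add: w(1))
  then have "?Q + ?Q = (\<Sum>i\<in>I. \<Sum>j\<in>I. l i * (w i j * (l i - l j))) + (\<Sum>i\<in>I. \<Sum>j\<in>I. l j * (w i j * (l j - l i)))"
    by simp
  also have "\<dots> = (\<Sum>i\<in>I. \<Sum>j\<in>I. w i j * (l i - l j)\<^sup>2)"
    unfolding sum.distrib[symmetric]
    by (intro sum.cong) (auto simp: power2_eq_square algebra_simps)
  also have "\<dots> \<ge> 0"
    by (intro sum_nonneg mult_nonneg_nonneg w) auto
  finally show ?thesis by simp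
qed

context two_phase_step
begin

section \<open>Nodal residuals and their continuity\<close>

lemma continuous_on_tilde:
  assumes f: "continuous_on {0..1} f" and t: "continuous_on A t" and s: "continuous_on A s"
  shows "continuous_on A (\<lambda>x. tilde (t x) f (s x))"
  unfolding tilde_def ext01_def
  by (rule continuous_on_compose2[OF f]) (auto intro!: continuous_intros t s)

lemma continuous_on_fw: "continuous_on {0..1} fw"
proof -
  have "\<eta>w s + \<eta>o s \<noteq> 0" if "s \<in> {0..1}" for s
    using total_mobility that by fastforce
  then show ?thesis
    unfolding fw_def by (intro continuous_intros mobilities_cont) auto
qed

lemma continuous_on_fo: "continuous_on {0..1} fo"
  unfolding fo_def by (intro continuous_intros continuous_on_fw)

text \<open>The flux depends continuously on the nodal values, although the upwind value does not.\<close>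

lemma upw_w_flux:
  "tilde t f (upw_w z l i j) * (l j - l i) = tilde t f (z i) * min 0 (l j - l i) + tilde t f (z j) * max 0 (l j - l i)"
  by (cases "l j < l i"; cases "l i < l j") (simp_all add: upw_w_def)

lemma upw_o_flux:
  "tilde t f (upw_o z p i j) * (p j - p i) = tilde t f (z i) * min 0 (p j - p i) + tilde t f (z j) * max 0 (p j - p i)"
  by (cases "p j < p i"; cases "p i < p j") (simp_all add: upw_o_def)

lemma P_o_node: "i \<in> nodes \<Longrightarrow> P_o t z l i = l i + tilde t pc (z i)"
  by (simp add: P_o_def I_h_node)

lemma source_node:
  "i \<in> nodes \<Longrightarrow> source t f z i = tilde t f (sI_h i) * (t * qI_h i) - tilde t f (z i) * (t * qO_h i)"
  by (simp add: source_def I_h_node)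

text \<open>The coefficient of \<open>\<Theta> i\<close> in \<open>rhs_A\<close>, that is, the
  residual of the wetting phase at node \<open>i\<close>. Mobility and pressure difference stay
  together in one product, the form that \<open>upw_w_flux\<close> rewrites.\<close>

definition coef_A :: "real \<Rightarrow> (real ^ 'd \<Rightarrow> real) \<Rightarrow> (real ^ 'd \<Rightarrow> real) \<Rightarrow> real ^ 'd \<Rightarrow> real" where
  "coef_A t z l i = m_\<phi> i * (z i - S i) / \<tau>
     - (\<Sum>j\<in>nodes. c i j * (tilde t \<eta>w (upw_w z l i j) * (l j - l i)))
     - m i * source t fw z i"

definition coef_B :: "real \<Rightarrow> (real ^ 'd \<Rightarrow> real) \<Rightarrow> (real ^ 'd \<Rightarrow> real) \<Rightarrow> real ^ 'd \<Rightarrow> real" where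
  "coef_B t z l i = - (m_\<phi> i * (z i - S i) / \<tau>)
     - (\<Sum>j\<in>nodes. c i j * (tilde t \<eta>o (upw_o z (P_o t z l) i j) * (P_o t z l j - P_o t z l i)))
     - m i * source t fo z i"

lemma rhs_A_eq: "rhs_A t z l \<Theta> = (\<Sum>i\<in>nodes. \<Theta> i * coef_A t z l i)"
  unfolding rhs_A_def coef_A_def inner_\<phi>_h_def inner_h_def sum_distrib_left[of "1 / \<tau>"] sum_subtractf[symmetric]
proof (rule sum.cong[OF refl])
  fix i
  have sum: "(\<Sum>j\<in>nodes. \<Theta> i * c i j * tilde t \<eta>w (upw_w z l i j) * (l j - l i)) =
      \<Theta> i * (\<Sum>j\<in>nodes. c i j * (tilde t \<eta>w (upw_w z l i j) * (l j - l i)))"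
    by (simp add: sum_distrib_left mult.assoc)
  have "1 / \<tau> * (p * a) - a * q - r * a = a * (p / \<tau> - q - r)" for a p q r
    by (simp add: algebra_simps)
  then show "1 / \<tau> * (m_\<phi> i * (z i - S i) * \<Theta> i)
      - (\<Sum>j\<in>nodes. \<Theta> i * c i j * tilde t \<eta>w (upw_w z l i j) * (l j - l i))
      - m i * source t fw z i * \<Theta> i =
    \<Theta> i * (m_\<phi> i * (z i - S i) / \<tau>
      - (\<Sum>j\<in>nodes. c i j * (tilde t \<eta>w (upw_w z l i j) * (l j - l i)))
      - m i * source t fw z i)"
    unfolding sum .
qed

lemma rhs_B_eq: "rhs_B t z l \<Theta> = (\<Sum>i\<in>nodes. \<Theta> i * coef_B t z l i)"
  unfolding rhs_B_def coef_B_def inner_\<phi>_h_def inner_h_def sum_distrib_left[of "- 1 / \<tau>"] sum_subtractf[symmetric]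
proof (rule sum.cong[OF refl])
  fix i
  let ?P = "P_o t z l"
  have sum: "(\<Sum>j\<in>nodes. \<Theta> i * c i j * tilde t \<eta>o (upw_o z ?P i j) * (?P j - ?P i)) =
      \<Theta> i * (\<Sum>j\<in>nodes. c i j * (tilde t \<eta>o (upw_o z ?P i j) * (?P j - ?P i)))"
    by (simp add: sum_distrib_left mult.assoc)
  have "- 1 / \<tau> * (p * a) - a * q - r * a = a * (- (p / \<tau>) - q - r)" for a p q r
    by (simp add: algebra_simps)
  then show "- 1 / \<tau> * (m_\<phi> i * (z i - S i) * \<Theta> i)
      - (\<Sum>j\<in>nodes. \<Theta> i * c i j * tilde t \<eta>o (upw_o z ?P i j) * (?P j - ?P i))
      - m i * source t fo z i * \<Theta> i =
    \<Theta> i * (- (m_\<phi> i * (z i - S i) / \<tau>)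
      - (\<Sum>j\<in>nodes. c i j * (tilde t \<eta>o (upw_o z ?P i j) * (?P j - ?P i)))
      - m i * source t fo z i)"
    unfolding sum .
qed

text \<open>Only nodal values enter the residuals, so a vector of nodal values may be exchanged for
  its interpolant.\<close>

lemma coef_cong:
  assumes i: "i \<in> nodes" and z: "\<And>j. j \<in> nodes \<Longrightarrow> z j = z' j" and l: "\<And>j. j \<in> nodes \<Longrightarrow> l j = l' j"
  shows "coef_A t z l i = coef_A t z' l' i" "coef_B t z l i = coef_B t z' l' i"
proof -
  have P: "P_o t z l j = P_o t z' l' j" if "j \<in> nodes" for j
    using that z l by (simp add: P_o_node)
  have source: "source t f z i = source t f z' i" for f
    using i z by (simp add: source_node)
  have "upw_w z l i j = upw_w z' l' i j" if "j \<in> nodes" for j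
    using i that z l by (simp add: upw_w_def)
  then show "coef_A t z l i = coef_A t z' l' i"
    unfolding coef_A_def source z[OF i] l[OF i] using l by (simp cong: sum.cong)
  have "upw_o z (P_o t z l) i j = upw_o z' (P_o t z' l') i j" if "j \<in> nodes" for j
    using i that z P by (simp add: upw_o_def)
  then show "coef_B t z l i = coef_B t z' l' i"
    unfolding coef_B_def source z[OF i] P[OF i] using P by (simp cong: sum.cong)
qed

lemma continuous_on_coef:
  fixes t :: "'x::topological_space \<Rightarrow> real"
  assumes i: "i \<in> nodes" and t: "continuous_on A t"
    and z: "\<And>j. j \<in> nodes \<Longrightarrow> continuous_on A (\<lambda>x. z x j)"
    and l: "\<And>j. j \<in> nodes \<Longrightarrow> continuous_on A (\<lambda>x. l x j)"
  shows "continuous_on A (\<lambda>x. coef_A (t x) (z x) (l x) i)"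
    and "continuous_on A (\<lambda>x. coef_B (t x) (z x) (l x) i)"
proof -
  have tilde: "continuous_on A (\<lambda>x. tilde (t x) f (z x j))" if "continuous_on {0..1} f" "j \<in> nodes" for f j
    using that by (intro continuous_on_tilde t z)
  have source: "continuous_on A (\<lambda>x. source (t x) f (z x) i)" if "continuous_on {0..1} f" for f
    unfolding source_node[OF i]
    by (intro continuous_on_diff continuous_on_mult continuous_on_const t tilde i that
        continuous_on_tilde[OF that])
  have mass: "continuous_on A (\<lambda>x. m_\<phi> i * (z x i - S i) / \<tau>)"
    using \<tau>_pos by (intro continuous_on_diff continuous_on_mult continuous_on_divide continuous_on_const z i) auto
  \<comment> \<open>Stated for any continuous mobility \<open>f\<close> and any nodal potential
    \<open>p\<close>, to serve both phases.\<close>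
  have flux: "continuous_on A (\<lambda>x. \<Sum>j\<in>nodes. c i j * (tilde (t x) f (z x i) * min 0 (p x j - p x i) +
      tilde (t x) f (z x j) * max 0 (p x j - p x i)))"
    if "continuous_on {0..1} f" "\<And>j. j \<in> nodes \<Longrightarrow> continuous_on A (\<lambda>x. p x j)"
    for f and p :: "'x \<Rightarrow> real ^ 'd \<Rightarrow> real"
    by (intro continuous_on_sum continuous_on_mult continuous_on_add continuous_on_min continuous_on_max
        continuous_on_diff continuous_on_const tilde that i)
  have "continuous_on A (\<lambda>x. \<Sum>j\<in>nodes. c i j *
      (tilde (t x) \<eta>w (upw_w (z x) (l x) i j) * (l x j - l x i)))"
    unfolding upw_w_flux by (rule flux[OF mobilities_cont(1) l])
  then show "continuous_on A (\<lambda>x. coef_A (t x) (z x) (l x) i)"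
    unfolding coef_A_def
    by (rule continuous_on_diff[OF continuous_on_diff[OF mass]
          continuous_on_mult[OF continuous_on_const source[OF continuous_on_fw]]])
  have P: "continuous_on A (\<lambda>x. P_o (t x) (z x) (l x) j)" if "j \<in> nodes" for j
    unfolding P_o_node[OF that] by (rule continuous_on_add[OF l[OF that] tilde[OF pc(2) that]])
  have "continuous_on A (\<lambda>x. \<Sum>j\<in>nodes. c i j *
      (tilde (t x) \<eta>o (upw_o (z x) (P_o (t x) (z x) (l x)) i j) *
        (P_o (t x) (z x) (l x) j - P_o (t x) (z x) (l x) i)))"
    unfolding upw_o_flux by (rule flux[OF mobilities_cont(2) P])
  then show "continuous_on A (\<lambda>x. coef_B (t x) (z x) (l x) i)"
    unfolding coef_B_def
    by (rule continuous_on_diff[OF continuous_on_diff[OF continuous_on_minus[OF mass]]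
          continuous_on_mult[OF continuous_on_const source[OF continuous_on_fo]]])
qed

section \<open>Conservation, and the passage from nodal residuals to zeros of
  \<open>F\<close>\<close>

lemma c_sym: "c i j = c j i"
  by (simp add: c_def Int_commute inner_commute)

lemma c_nonneg: "0 \<le> c i j"
  unfolding c_def set_lebesgue_integral_def by (rule Bochner_Integration.integral_nonneg) auto

text \<open>The accumulation terms of the two phases cancel, each flux is antisymmetric in its two
  nodes, and the fractional flows add up to 1, which leaves the difference of the total
  sources.\<close>

lemma sum_coef_eq_0: "(\<Sum>i\<in>nodes. coef_A t z l i + coef_B t z l i) = 0"
proof -
  have w: "(\<Sum>i\<in>nodes. \<Sum>j\<in>nodes. c i j * (tilde t \<eta>w (upw_w z l i j) * (l j - l i))) = 0"
  proof (rule sum_antisym_eq_0)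
    fix i j
    have "upw_w z l j i = upw_w z l i j" by (auto simp: upw_w_def max.commute)
    then show "c i j * (tilde t \<eta>w (upw_w z l i j) * (l j - l i)) =
        - (c j i * (tilde t \<eta>w (upw_w z l j i) * (l i - l j)))"
      by (simp add: c_sym[of j i] right_diff_distrib)
  qed
  have o: "(\<Sum>i\<in>nodes. \<Sum>j\<in>nodes. c i j * (tilde t \<eta>o (upw_o z (P_o t z l) i j) *
      (P_o t z l j - P_o t z l i))) = 0"
  proof (rule sum_antisym_eq_0)
    fix i j
    let ?p = "P_o t z l"
    have "upw_o z ?p j i = upw_o z ?p i j" by (auto simp: upw_o_def min.commute)
    then show "c i j * (tilde t \<eta>o (upw_o z ?p i j) * (?p j - ?p i)) =
        - (c j i * (tilde t \<eta>o (upw_o z ?p j i) * (?p i - ?p j)))"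
      by (simp add: c_sym[of j i] right_diff_distrib)
  qed
  have fo: "tilde t fo s = 1 - tilde t fw s" for s
    by (simp add: tilde_def ext01_def fo_def)
  have "m i * source t fw z i + m i * source t fo z i = t * (m i * qI_h i - m i * qO_h i)"
    if "i \<in> nodes" for i
    by (simp add: source_node[OF that] fo algebra_simps)
  then have "(\<Sum>i\<in>nodes. m i * source t fw z i + m i * source t fo z i) = 0"
    using source_balance by (simp add: sum_subtractf flip: sum_distrib_left)
  then show ?thesis using w o
    by (simp add: coef_A_def coef_B_def sum.distrib sum_subtractf sum_negf)
qed

text \<open>For the definite description the zero function must be the only candidate. Testing a
  candidate with itself gives a vanishing integral of its square; continuity then yields 0 on
  \<Omega> and its closure, and outside functions in \<open>X_h\<close> vanish anyway.\<close>

lemma riesz_eq_0: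
  assumes "\<And>\<Theta>. \<Theta> \<in> X_h \<Longrightarrow> l \<Theta> = 0"
  shows "riesz l = (\<lambda>_. 0)"
  unfolding riesz_def
proof (rule the_equality)
  show "(\<lambda>_. 0) \<in> X_h \<and> (\<forall>\<Theta>\<in>X_h. (LINT x:\<Omega>|lebesgue. 0 * \<Theta> x) = l \<Theta>)"
    using X_h_0 by (auto simp: assms)
next
  fix u assume u: "u \<in> X_h \<and> (\<forall>\<Theta>\<in>X_h. (LINT x:\<Omega>|lebesgue. u x * \<Theta> x) = l \<Theta>)"
  then have X: "u \<in> X_h" ..
  have "(LINT x:\<Omega>|lebesgue. u x * u x) = l u" using u X by blast
  then have int0: "(LINT x:\<Omega>|lebesgue. u x * u x) = 0" using assms[OF X] by simp
  have cont: "continuous_on (closure \<Omega>) u" using X by (simp add: X_h_def)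
  have "set_integrable lebesgue \<Omega> (\<lambda>x. u x * u x)"
  proof (rule set_integrable_subset)
    show "set_integrable lebesgue (closure \<Omega>) (\<lambda>x. u x * u x)"
      by (intro set_integrable_closure continuous_on_mult cont)
  qed (use open_domain closure_subset in \<open>auto simp: borel_open\<close>)
  then have "AE x in lebesgue. indicator \<Omega> x * (u x * u x) = 0"
    using int0 integral_nonneg_eq_0_iff_AE[of lebesgue "\<lambda>x. indicator \<Omega> x * (u x * u x)"]
    by (simp add: set_integrable_def set_lebesgue_integral_def)
  then have "AE x in lebesgue. x \<notin> {x \<in> \<Omega>. u x \<noteq> 0}"
    by eventually_elim (auto simp: indicator_def)
  moreover have op: "open {x \<in> \<Omega>. u x \<noteq> 0}"
  proof -
    have "open (\<Omega> \<inter> u -` (- {0}))"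
      using continuous_on_subset[OF cont closure_subset] open_domain
      by (intro continuous_open_preimage) auto
    moreover have "\<Omega> \<inter> u -` (- {0}) = {x \<in> \<Omega>. u x \<noteq> 0}" by auto
    ultimately show ?thesis by simp
  qed
  ultimately have "negligible {x \<in> \<Omega>. u x \<noteq> 0}"
    by (subst negligible_iff_null_sets, subst AE_iff_null_sets) (auto simp: borel_open)
  then have "{x \<in> \<Omega>. u x \<noteq> 0} = {}"
    using open_not_negligible[OF op] by blast
  then have \<Omega>0: "u x = 0" if "x \<in> \<Omega>" for x using that by auto
  have "u x = 0" for x
  proof (cases "x \<in> closure \<Omega>")
    case True
    then show ?thesis
      using continuous_constant_on_closure[OF cont, of 0 x] \<Omega>0 by blast
  next
    case False
    then show ?thesis using X by (simp add: X_h_def)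
  qed
  then show "u = (\<lambda>_. 0)" by blast
qed

lemma F_eq_0:
  assumes "\<And>i. i \<in> nodes \<Longrightarrow> coef_A t \<zeta> \<Lambda> i = 0" "\<And>i. i \<in> nodes \<Longrightarrow> coef_B t \<zeta> \<Lambda> i = 0"
  shows "F t \<zeta> \<Lambda> = ((\<lambda>_. 0), (\<lambda>_. 0))"
  using assms by (simp add: F_def A_h_def B_h_def rhs_A_eq rhs_B_eq riesz_eq_0)

lemma X0_h_iff: "u \<in> X_h \<Longrightarrow> u \<in> X0_h \<longleftrightarrow> (\<Sum>i\<in>nodes. m i * u i) = 0"
  by (simp add: X0_h_def integral_X_h)

text \<open>One term of the sum defining the squared norm is at most the whole. This turns the norm
  bound on zeros into a bound on coordinates.\<close>

lemma node_le_norm_h: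
  assumes "i \<in> nodes"
  shows "\<bar>u i\<bar> \<le> norm_h u / sqrt (m i)"
proof -
  have "m i * u i * u i \<le> inner_h u u"
    unfolding inner_h_def using finite_nodes assms m_pos
    by (intro member_le_sum[where f = "\<lambda>i. m i * u i * u i"]) (auto simp: mult.assoc less_imp_le)
  then have "sqrt (m i * u i * u i) \<le> norm_h u" by (simp add: norm_h_def)
  moreover have "sqrt (m i * u i * u i) = sqrt (m i) * \<bar>u i\<bar>"
    by (simp add: mult.assoc real_sqrt_mult)
  ultimately show ?thesis using m_pos[OF assms] by (simp add: field_simps)
qed

lemma tilde_0: "tilde 0 f s = f \<theta>"
  using \<theta> by (simp add: tilde_def ext01_def)

lemma norm_h_nonneg: "0 \<le> norm_h u"
  unfolding norm_h_def inner_h_def using m_pos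
  by (intro real_sqrt_ge_zero sum_nonneg) (auto simp: mult.assoc less_imp_le)

text \<open>At \<open>t = 0\<close> the capillary pressure is constant, so both phases have the same
  pressure differences, and the sources vanish. The summed residual is then a graph Laplacian with
  weights \<open>c i j\<close> times the total mobility at \<theta>.\<close>

lemma coef_0_sum_nonneg:
  "0 \<le> (\<Sum>i\<in>nodes. l i * (coef_A 0 z l i + coef_B 0 z l i))"
proof -
  let ?\<eta> = "\<eta>w \<theta> + \<eta>o \<theta>"
  have \<eta>: "0 \<le> ?\<eta>" using mobilities_nonneg[OF \<theta>] by simp
  have "coef_A 0 z l i + coef_B 0 z l i = (\<Sum>j\<in>nodes. (?\<eta> * c i j) * (l i - l j))"
    if i: "i \<in> nodes" for i
  proof -
    have P: "P_o 0 z l j - P_o 0 z l i = l j - l i" if "j \<in> nodes" for j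
      using i that by (simp add: P_o_node tilde_0)
    have "coef_A 0 z l i + coef_B 0 z l i =
        - (\<Sum>j\<in>nodes. c i j * (\<eta>w \<theta> * (l j - l i))) - (\<Sum>j\<in>nodes. c i j * (\<eta>o \<theta> * (l j - l i)))"
      by (simp add: coef_A_def coef_B_def source_node[OF i] tilde_0 P cong: sum.cong)
    also have "\<dots> = (\<Sum>j\<in>nodes. (?\<eta> * c i j) * (l i - l j))"
      unfolding sum_negf[symmetric] sum_subtractf[symmetric]
      by (intro sum.cong) (auto simp: algebra_simps)
    finally show ?thesis .
  qed
  then have "(\<Sum>i\<in>nodes. l i * (coef_A 0 z l i + coef_B 0 z l i)) =
      (\<Sum>i\<in>nodes. \<Sum>j\<in>nodes. l i * ((?\<eta> * c i j) * (l i - l j)))"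
    by (simp add: sum_distrib_left)
  also have "\<dots> \<ge> 0"
    by (rule sum_symmetric_nonneg) (use \<eta> c_nonneg in \<open>auto simp: c_sym\<close>)
  finally show ?thesis .
qed

text \<open>The unknowns are nodal values, \<open>Inl\<close> for \<zeta> and \<open>Inr\<close> for
  \<Lambda>, with no constraint on the mean, so that \<open>homotopy_zero\<close> applies on a full
  coordinate space.\<close>

lemma ex_zero_F:
  assumes R1: "R1 > 0"
    and apriori: "\<And>t \<zeta> \<Lambda>. t \<in> {0..1} \<Longrightarrow> \<zeta> \<in> X_h \<Longrightarrow> \<Lambda> \<in> X0_h \<Longrightarrow>
        F t \<zeta> \<Lambda> = ((\<lambda>_. 0), (\<lambda>_. 0)) \<Longrightarrow> norm_h \<zeta> + norm_h \<Lambda> \<le> R1"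
  shows "\<exists>\<zeta>\<in>X_h. \<exists>\<Lambda>\<in>X0_h. F 1 \<zeta> \<Lambda> = ((\<lambda>_. 0), (\<lambda>_. 0))"
proof -
  define V where "V = nodes <+> nodes"
  define mean where "mean l = (\<Sum>j\<in>nodes. m j * l j)" for l :: "real ^ 'd \<Rightarrow> real"
  \<comment> \<open>On the first half of the parameter interval \<alpha> rises from 0 to 1 while
    \<beta> is 0; on the second half \<alpha> is 1 and \<beta>, which plays the part of
    \<open>t\<close>, rises from 0 to 1.\<close>
  define \<alpha> \<beta> where "\<alpha> u = min 1 (2 * u)" and "\<beta> u = max 0 (2 * u - 1)" for u :: real
  \<comment> \<open>The term \<open>m i * mean l\<close> builds the mean constraint into the
    equations. With the weight \<open>m i\<close> it contributes the square of \<open>mean l\<close>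
    when tested with \<open>l\<close>.\<close>
  define H where "H u x = (\<lambda>v.
    let z = (\<lambda>j. x (Inl j)); l = (\<lambda>j. x (Inr j)) in
    case v of Inl i \<Rightarrow> (1 - \<alpha> u) * z i + \<alpha> u * coef_A (\<beta> u) z l i
      | Inr i \<Rightarrow> (1 - \<alpha> u) * l i + \<alpha> u * (coef_A (\<beta> u) z l i + coef_B (\<beta> u) z l i + m i * mean l))"
    for u and x :: "(real ^ 'd) + (real ^ 'd) \<Rightarrow> real"
  have solution: "I_h (\<lambda>j. x (Inl j)) \<in> X_h \<and> I_h (\<lambda>j. x (Inr j)) \<in> X0_h \<and>
      F (\<beta> u) (I_h (\<lambda>j. x (Inl j))) (I_h (\<lambda>j. x (Inr j))) = ((\<lambda>_. 0), (\<lambda>_. 0))"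
    if \<alpha>: "\<alpha> u = 1" and zero: "\<forall>v\<in>V. H u x v = 0" for u x
  proof -
    define z l where "z = (\<lambda>j. x (Inl j))" and "l = (\<lambda>j. x (Inr j))"
    have A: "coef_A (\<beta> u) z l i = 0" if "i \<in> nodes" for i
      using zero[rule_format, of "Inl i"] that \<alpha> by (auto simp: H_def V_def z_def l_def Let_def)
    have AB: "coef_A (\<beta> u) z l i + coef_B (\<beta> u) z l i + m i * mean l = 0" if "i \<in> nodes" for i
      using zero[rule_format, of "Inr i"] that \<alpha> by (auto simp: H_def V_def z_def l_def Let_def)
    \<comment> \<open>Summation over the nodes removes the residuals and leaves the total mass times
      \<open>mean l\<close>, so the mean vanishes and the residuals are zero separately.\<close>
    have "(\<Sum>i\<in>nodes. coef_A (\<beta> u) z l i + coef_B (\<beta> u) z l i + m i * mean l) = 0"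
      using AB by simp
    then have "(\<Sum>i\<in>nodes. m i) * mean l = 0"
      using sum_coef_eq_0[of "\<beta> u" z l] by (simp add: sum.distrib sum_distrib_right)
    then have mean: "mean l = 0" using sum_m_pos by simp
    have B: "coef_B (\<beta> u) z l i = 0" if "i \<in> nodes" for i
      using A[OF that] AB[OF that] mean by simp
    have "F (\<beta> u) (I_h z) (I_h l) = ((\<lambda>_. 0), (\<lambda>_. 0))"
    proof (rule F_eq_0)
      fix i assume i: "i \<in> nodes"
      show "coef_A (\<beta> u) (I_h z) (I_h l) i = 0" "coef_B (\<beta> u) (I_h z) (I_h l) i = 0"
        using coef_cong[OF i, of "I_h z" z "I_h l" l "\<beta> u"] A[OF i] B[OF i] by (simp_all add: I_h_node)
    qed
    moreover have "I_h l \<in> X0_h"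
      using mean by (simp add: X0_h_iff[OF I_h_in] I_h_node mean_def)
    ultimately show ?thesis by (simp add: I_h_in z_def l_def)
  qed
  \<comment> \<open>The sum dominates the coordinate bound of every node on the second half of the
    homotopy; the summand 1 covers the first half, where the nodal values of \<open>z\<close> are at
    most 1 in absolute value.\<close>
  define R where "R = 1 + (\<Sum>i\<in>nodes. R1 / sqrt (m i))"
  have R: "R1 / sqrt (m i) \<le> R" if "i \<in> nodes" for i
  proof -
    have "R1 / sqrt (m i) \<le> (\<Sum>i\<in>nodes. R1 / sqrt (m i))"
      using finite_nodes that R1 m_pos by (intro member_le_sum) (auto simp: less_imp_le)
    then show ?thesis by (simp add: R_def)
  qed
  have R_ge: "1 \<le> R"
    unfolding R_def using R1 m_pos by (simp add: sum_nonneg less_imp_le)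
  have "\<exists>x. \<forall>v\<in>V. H 1 x v = 0"
  proof (rule homotopy_zero)
    show "finite V" using finite_nodes by (simp add: V_def)
    show "H 0 x v = x v" for x v
      by (simp add: H_def \<alpha>_def Let_def split: sum.split)
    show "continuous_on ({0..1} \<times> UNIV) (\<lambda>(u, x). H u x v)" if "v \<in> V" for v
    proof -
      have x: "continuous_on ({0..1} \<times> UNIV) (\<lambda>p. snd p w)"
        for w :: "(real ^ 'd) + (real ^ 'd)"
        by (rule continuous_on_compose2[OF continuous_on_product_coordinates continuous_on_snd[OF continuous_on_id]]) auto
      have ab: "continuous_on ({0..1} \<times> UNIV) (\<lambda>p. \<alpha> (fst p))" "continuous_on ({0..1} \<times> UNIV) (\<lambda>p. \<beta> (fst p))"
        unfolding \<alpha>_def \<beta>_def by (intro continuous_intros)+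
      note [continuous_intros] = continuous_on_coef x ab
      show ?thesis
        using that unfolding V_def H_def mean_def case_prod_beta Let_def
        by (auto intro!: continuous_intros)
    qed
    fix u x v
    assume u: "u \<in> {0..1::real}" and zero: "\<forall>v\<in>V. H u x v = 0" and v: "v \<in> V"
    show "\<bar>x v\<bar> \<le> R"
    proof (cases "\<alpha> u = 1")
      case True
      let ?\<zeta> = "I_h (\<lambda>j. x (Inl j))" and ?\<Lambda> = "I_h (\<lambda>j. x (Inr j))"
      have "\<beta> u \<in> {0..1}" using u by (auto simp: \<beta>_def)
      then have le: "norm_h ?\<zeta> + norm_h ?\<Lambda> \<le> R1"
        using solution[OF True zero] by (intro apriori) auto
      obtain i where i: "i \<in> nodes" "v = Inl i \<or> v = Inr i" using v by (auto simp: V_def)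
      have "\<bar>x v\<bar> \<le> R1 / sqrt (m i)"
      proof -
        have "\<bar>x (Inl i)\<bar> \<le> norm_h ?\<zeta> / sqrt (m i)" "\<bar>x (Inr i)\<bar> \<le> norm_h ?\<Lambda> / sqrt (m i)"
          using node_le_norm_h[OF i(1), of ?\<zeta>] node_le_norm_h[OF i(1), of ?\<Lambda>] i(1) by (simp_all add: I_h_node)
        moreover have "norm_h ?\<zeta> / sqrt (m i) \<le> R1 / sqrt (m i)" "norm_h ?\<Lambda> / sqrt (m i) \<le> R1 / sqrt (m i)"
          using le norm_h_nonneg[of ?\<zeta>] norm_h_nonneg[of ?\<Lambda>] m_pos[OF i(1)]
          by (auto intro!: divide_right_mono)
        ultimately show ?thesis using i(2) by fastforce
      qed
      then show ?thesis using R[OF i(1)] by simp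
    next
      case False
      define z l where "z = (\<lambda>j. x (Inl j))" and "l = (\<lambda>j. x (Inr j))"
      have \<alpha>: "0 \<le> \<alpha> u" "\<alpha> u < 1" and \<beta>: "\<beta> u = 0"
        using u False by (auto simp: \<alpha>_def \<beta>_def min_def split: if_splits)
      \<comment> \<open>The equation at node \<open>i\<close> multiplied by \<open>l i\<close>.
        After summation every term is nonnegative, and the factor \<open>1 - \<alpha> u\<close> is
        positive, so \<open>l\<close> vanishes at the nodes.\<close>
      have "(1 - \<alpha> u) * (l i * l i) + \<alpha> u * (l i * (coef_A 0 z l i + coef_B 0 z l i) + m i * l i * mean l) = 0"
        if "i \<in> nodes" for i
      proof -
        have "(1 - \<alpha> u) * l i + \<alpha> u * (coef_A 0 z l i + coef_B 0 z l i + m i * mean l) = 0"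
          using zero[rule_format, of "Inr i"] that \<beta> by (auto simp: H_def V_def z_def l_def Let_def)
        from arg_cong[OF this, of "\<lambda>y. l i * y"] show ?thesis by (simp add: algebra_simps)
      qed
      then have "(\<Sum>i\<in>nodes. (1 - \<alpha> u) * (l i * l i) +
          \<alpha> u * (l i * (coef_A 0 z l i + coef_B 0 z l i) + m i * l i * mean l)) = 0"
        by simp
      then have "(1 - \<alpha> u) * (\<Sum>i\<in>nodes. l i * l i) +
          \<alpha> u * ((\<Sum>i\<in>nodes. l i * (coef_A 0 z l i + coef_B 0 z l i)) + mean l * mean l) = 0"
        by (simp add: sum.distrib mean_def flip: sum_distrib_left sum_distrib_right)
      moreover have "0 \<le> \<alpha> u * ((\<Sum>i\<in>nodes. l i * (coef_A 0 z l i + coef_B 0 z l i)) + mean l * mean l)"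
        using \<alpha> coef_0_sum_nonneg[of l z] by simp
      ultimately have "(1 - \<alpha> u) * (\<Sum>i\<in>nodes. l i * l i) \<le> 0" by linarith
      then have "(\<Sum>i\<in>nodes. l i * l i) \<le> 0"
        using \<alpha> by (simp add: mult_le_0_iff)
      then have "(\<Sum>i\<in>nodes. l i * l i) = 0"
        by (simp add: sum_nonneg order.antisym)
      then have l0: "l i = 0" if "i \<in> nodes" for i
        using that finite_nodes by (simp add: sum_nonneg_eq_0_iff)
      obtain i where i: "i \<in> nodes" "v = Inl i \<or> v = Inr i" using v by (auto simp: V_def)
      define k where "k = m_\<phi> i / \<tau>"
      have k: "0 < k" using m_\<phi>_pos[OF i(1)] \<tau>_pos by (simp add: k_def)
      \<comment> \<open>With \<open>l\<close> zero at all nodes and no sources, only the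
        accumulation term is left.\<close>
      have "coef_A 0 z l i = k * (z i - S i)"
        using i(1) by (simp add: coef_A_def source_node l0 k_def)
      moreover have "(1 - \<alpha> u) * z i + \<alpha> u * coef_A 0 z l i = 0"
        using zero[rule_format, of "Inl i"] i(1) \<beta> by (auto simp: H_def V_def z_def l_def Let_def)
      ultimately have "(1 - \<alpha> u) * z i + \<alpha> u * (k * (z i - S i)) = 0" by simp
      \<comment> \<open>The factor of \<open>S i\<close> on the right is at most the factor of
        \<open>z i\<close> on the left, so \<open>z i\<close> inherits the bound 1 from
        \<open>S i\<close>.\<close>
      then have zi: "((1 - \<alpha> u) + \<alpha> u * k) * z i = \<alpha> u * k * S i"
        by (simp add: algebra_simps)
      let ?D = "(1 - \<alpha> u) + \<alpha> u * k"
      have D: "0 < ?D" using \<alpha> k by (simp add: add_pos_nonneg)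
      have "0 \<le> S i" "S i \<le> 1" using S(2) nodes_subset i(1) by auto
      then have "\<bar>\<alpha> u * k * S i\<bar> \<le> \<alpha> u * k * 1"
        unfolding abs_mult using \<alpha> k by (intro mult_mono) auto
      then have "?D * \<bar>z i\<bar> \<le> \<alpha> u * k"
        using arg_cong[OF zi, of abs] D by (simp add: abs_mult)
      also have "\<dots> \<le> ?D * 1" using \<alpha> by simp
      finally have "\<bar>z i\<bar> \<le> 1" using D mult_le_cancel_left_pos by blast
      then show ?thesis using i l0[OF i(1)] R_ge by (auto simp: z_def l_def)
    qed
  qed
  then obtain x where "\<forall>v\<in>V. H 1 x v = 0" ..
  from solution[OF _ this] show ?thesis by (auto simp: \<alpha>_def \<beta>_def)
qed

end

theorem theorem4p4:
  fixes \<Omega> :: "(real ^ 'd) set" and T :: real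
    and \<phi> :: "real ^ 'd \<Rightarrow> real"
    and \<eta>w \<eta>o pc :: "real \<Rightarrow> real"
    and sI qI qO :: "real ^ 'd \<Rightarrow> real \<Rightarrow> real"
    and \<T> :: "(real ^ 'd) set set" and \<sigma> :: real
    and N n :: nat
    and S :: "real ^ 'd \<Rightarrow> real" and \<theta> R1 :: real
  assumes "two_phase_step \<Omega> T \<phi> \<eta>w \<eta>o pc sI qI qO \<T> \<sigma> N n S \<theta>"
    and "R1 > 0"
    and "\<And>t \<zeta> \<Lambda>. t \<in> {0..1} \<Longrightarrow>
           \<zeta> \<in> two_phase_scheme.X_h \<Omega> \<T> \<Longrightarrow> \<Lambda> \<in> two_phase_scheme.X0_h \<Omega> \<T> \<Longrightarrow>
           two_phase_scheme.F \<Omega> T \<phi> \<eta>w \<eta>o pc sI qI qO \<T> N n S \<theta> t \<zeta> \<Lambda> = ((\<lambda>_. 0), (\<lambda>_. 0)) \<Longrightarrow>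
           two_phase_scheme.norm_h \<T> \<zeta> + two_phase_scheme.norm_h \<T> \<Lambda> \<le> R1"
  shows "\<exists>(\<zeta>, \<Lambda>) \<in> two_phase_scheme.ball_h \<Omega> \<T> (R1 + 1).
           two_phase_scheme.F \<Omega> T \<phi> \<eta>w \<eta>o pc sI qI qO \<T> N n S \<theta> 1 \<zeta> \<Lambda> = ((\<lambda>_. 0), (\<lambda>_. 0))"
proof -
  interpret two_phase_step \<Omega> T \<phi> \<eta>w \<eta>o pc sI qI qO \<T> \<sigma> N n S \<theta>
    by (rule assms(1))
  have "\<exists>\<zeta>\<in>X_h. \<exists>\<Lambda>\<in>X0_h. F 1 \<zeta> \<Lambda> = ((\<lambda>_. 0), (\<lambda>_. 0))"
    by (rule ex_zero_F[OF assms(2)]) (rule assms(3))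
  then obtain \<zeta> \<Lambda> where sol: "\<zeta> \<in> X_h" "\<Lambda> \<in> X0_h" "F 1 \<zeta> \<Lambda> = ((\<lambda>_. 0), (\<lambda>_. 0))"
    by blast
  then have "norm_h \<zeta> + norm_h \<Lambda> \<le> R1 + 1"
    using assms(3)[OF _ sol] by simp
  with sol show ?thesis by (auto simp: ball_h_def)
qed

end
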